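(* Let $\mathcal P_t=e^{t\mathcal L}$ be an ergodic quantum Markov semigroup on $\mathcal A$ that satisfies the $\sigma$-DBC for $\sigma\in\mathfrak S_+(\mathcal A)$. Then $$\frac{\partial}{\partial t}\rho=\mathcal L^\dagger\rho$$ is gradient flow for the relative entropy $D(\cdot\|\sigma)$ in the Riemannian metric $g_{\mathcal L}$ on $\mathfrak S_+(\mathcal A)$ canonically associated to $\mathcal L$ through its representation in standard form.
   Context: $\mathcal A$ is a finite-dimensional $C^*$-algebra with unit $\mathbf 1$, regarded as a unital $C^*$-subalgebra of the $n\times n$ complex matrices $\mathcal M_n(\mathbb C)$; $\operatorname{Tr}$ is the trace and $\tau=\operatorname{Tr}[\cdot]/\operatorname{Tr}[\mathbf 1]$ the normalized trace. $\mathfrak H_{\mathcal A}$ is $\mathcal A$ with the inner product $\langle A,B\rangle_{\mathfrak H_{\mathcal A}}=\tau[A^*B]$; $\dagger$ denotes the adjoint with respect to this inner product (equivalently, with respect to $\operatorname{Tr}[A^*B]$). $\mathfrak S_+(\mathcal A)$ is the set of invertible density matrices belonging to $\mathcal A$ (positive definite $\rho\in\mathcal A$ with $\operatorname{Tr}\rho=1$). The relative entropy is $D(\rho\|\sigma)=\operatorname{Tr}[\rho(\log\rho-\log\sigma)]$. A quantum Markov semigroup (QMS) on $\mathcal A$ is a continuous one-parameter semigroup $(\mathcal P_t)_{t\ge0}$ of completely positive linear maps on $\mathcal A$ with $\mathcal P_t\mathbf 1=\mathbf 1$. It is ergodic if for $t>0$ the eigenspace of $\mathcal P_t$ for the eigenvalue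 $1$ is spanned by $\mathbf 1$. It satisfies the $\sigma$-DBC if for each $t>0$, $\mathcal P_t$ is self-adjoint for the inner product $\langle A,B\rangle_1=\operatorname{Tr}[\sigma A^*B]$. $\Delta_\sigma(A)=\sigma A\sigma^{-1}$. Standard form: $\mathcal LA=\sum_{j\in\mathcal J}e^{-\omega_j/2}\big(V_j^*[A,V_j]+[V_j^*,A]V_j\big)$, where $\omega_j\in\mathbb R$ and $\{V_j\}_{j\in\mathcal J}\subset\mathcal M_n(\mathbb C)$ satisfies $\tau[V_j^*V_k]=\delta_{j,k}$, $\tau[V_j]=0$, $\{V_j\}_{j\in\mathcal J}=\{V_j^*\}_{j\in\mathcal J}$, and $\Delta_\sigma V_j=e^{-\omega_j}V_j$. Differential calculus: operators $\partial_j$ on $\mathcal A$ are defined by $\partial_jA=[V_j,A]$, so that $\partial_j^\dagger A=[V_j^*,A]$; $\nabla A=(\partial_jA)_{j\in\mathcal J}$ and $\operatorname{div}(A_j)_{j\in\mathcal J}=-\sum_j\partial_j^\dagger A_j=\sum_j[A_j,V_j^*]$. For $\rho\in\mathfrak S_+(\mathcal A)$ and $\omega\in\mathbb R$, $[\rho]_\omega A=\int_0^1e^{\omega(s-1/2)}\rho^sA\rho^{1-s}\,ds$, and $[\rho]_{\vec\omega}(A_j)_j=([\rho]_{\omega_j}A_j)_j$. Metric $g_{\mathcal L}$: for vector fields $\mathbf W=(W_j)_j$, $\mathbf X=(X_j)_j$ in $\bigoplus_{j\in\mathcal J}\mathcal A$ put $\langle\mathbf W,\mathbf X\rangle_{\mathcal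 L,\rho}=\sum_{j\in\mathcal J}\langle W_j,[\rho]_{\omega_j}X_j\rangle_{\mathfrak H_{\mathcal A}}$, with norm $\|\cdot\|_{\mathcal L,\rho}$. The tangent space at $\rho$ is identified with $\{\nabla U:U\in\mathcal A,\ U=U^*\}$ through the one-to-one correspondence $\dot\rho(0)=-\operatorname{div}([\rho]_{\vec\omega}\nabla U)$, where $\rho(t)$ is a differentiable path in $\mathfrak S_+(\mathcal A)$ with $\rho(0)=\rho$, and one sets $\|\dot\rho(0)\|^2_{g_{\mathcal L,\rho}}=\|\nabla U\|^2_{\mathcal L,\rho}$. Gradient flow for a function means the steepest descent flow, i.e. motion along minus its Riemannian gradient.
   Formalization: The metric used is Tr[1] times g_L, i.e. g_L computed with Tr[A*B] in place of τ[A*B]; with τ in the metric and Tr in D, the literal claim is off by the factor Tr[1] (e.g. Pauli generator on M_2, σ=1/2: e'=-8e versus -16e). *)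

theory Defs
  imports "HOL-Analysis.Analysis"
begin

type_synonym 'n cmat = "complex^'n^'n"

text \<open>Matrices. Complex scalar multiplication of a matrix is written \<open>mat c ** A\<close>.\<close>

definition cadj :: "'n cmat \<Rightarrow> 'n::finite cmat" where
  "cadj A = (\<chi> i j. cnj (A $ j $ i))"

definition commutator :: "'n cmat \<Rightarrow> 'n cmat \<Rightarrow> 'n::finite cmat" where
  "commutator A B = A ** B - B ** A"

definition sesq :: "complex^'n \<Rightarrow> 'n cmat \<Rightarrow> complex^'n::finite \<Rightarrow> complex" where
  "sesq v A w = (\<Sum>i\<in>UNIV. cnj (v $ i) * (A *v w) $ i)"

definition pos_def :: "'n::finite cmat \<Rightarrow> bool" where
  "pos_def A \<longleftrightarrow> cadj A = A \<and> (\<forall>v. v \<noteq> 0 \<longrightarrow> 0 < Re (sesq v A v))"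

definition tau :: "'n::finite cmat \<Rightarrow> complex" where
  "tau A = trace A / trace (mat 1 :: 'n cmat)"

definition inner_H :: "'n cmat \<Rightarrow> 'n::finite cmat \<Rightarrow> complex" where
  "inner_H A B = tau (cadj A ** B)"

text \<open>Functional calculus for self-adjoint matrices, by unitary diagonalization; the result does
  not depend on the diagonalization chosen. It is only used for self-adjoint arguments.\<close>

definition unitary_mat :: "'n::finite cmat \<Rightarrow> bool" where
  "unitary_mat U \<longleftrightarrow> cadj U ** U = mat 1 \<and> U ** cadj U = mat 1"

definition real_diag :: "('n \<Rightarrow> real) \<Rightarrow> 'n::finite cmat" where
  "real_diag d = (\<chi> i j. if i = j then complex_of_real (d i) else 0)"

definition mat_fun :: "(real \<Rightarrow> real) \<Rightarrow> 'n cmat \<Rightarrow> 'n::finite cmat" where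
  "mat_fun f A = (THE B. \<exists>U d. unitary_mat U \<and> A = U ** real_diag d ** cadj U
                              \<and> B = U ** real_diag (f \<circ> d) ** cadj U)"

definition mat_ln :: "'n cmat \<Rightarrow> 'n::finite cmat" where
  "mat_ln = mat_fun ln"

definition mat_powr :: "'n cmat \<Rightarrow> real \<Rightarrow> 'n::finite cmat" where
  "mat_powr A s = mat_fun (\<lambda>x. x powr s) A"

text \<open>Algebras, states, relative entropy. Norm-closedness of the subalgebra is automatic in
  finite dimension.\<close>

definition unital_cstar_subalgebra :: "'n::finite cmat set \<Rightarrow> bool" where
  "unital_cstar_subalgebra \<A> \<longleftrightarrow> mat 1 \<in> \<A>
     \<and> (\<forall>A\<in>\<A>. \<forall>B\<in>\<A>. A + B \<in> \<A> \<and> A ** B \<in> \<A>)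
     \<and> (\<forall>A\<in>\<A>. cadj A \<in> \<A> \<and> (\<forall>c. mat c ** A \<in> \<A>))"

definition inv_densities :: "'n::finite cmat set \<Rightarrow> 'n cmat set" where
  "inv_densities \<A> = {\<rho> \<in> \<A>. pos_def \<rho> \<and> trace \<rho> = 1}"

definition rel_entropy :: "'n cmat \<Rightarrow> 'n::finite cmat \<Rightarrow> real" where
  "rel_entropy \<rho> \<sigma> = Re (trace (\<rho> ** (mat_ln \<rho> - mat_ln \<sigma>)))"

text \<open>Operators on \<open>\<A>\<close> are functions on all matrices whose values outside \<open>\<A>\<close> are irrelevant.\<close>

definition linear_op_on :: "'n::finite cmat set \<Rightarrow> ('n cmat \<Rightarrow> 'n cmat) \<Rightarrow> bool" where
  "linear_op_on \<A> T \<longleftrightarrow> (\<forall>A\<in>\<A>. T A \<in> \<A>)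
     \<and> (\<forall>A\<in>\<A>. \<forall>B\<in>\<A>. T (A + B) = T A + T B)
     \<and> (\<forall>c. \<forall>A\<in>\<A>. T (mat c ** A) = mat c ** T A)"

text \<open>A matrix \<open>X\<close> with entries \<open>X k l \<in> \<A>\<close>, \<open>k, l < m\<close>, is an element of \<open>\<A> \<otimes> M\<^sub>m\<close>, acting on
  \<open>m\<close>-tuples of vectors; complete positivity is positivity of \<open>T \<otimes> id\<close> on \<open>\<A> \<otimes> M\<^sub>m\<close>
  for every \<open>m\<close>.\<close>

definition block_pos :: "nat \<Rightarrow> (nat \<Rightarrow> nat \<Rightarrow> 'n::finite cmat) \<Rightarrow> bool" where
  "block_pos m X \<longleftrightarrow> (\<forall>v. (\<Sum>k<m. \<Sum>l<m. sesq (v k) (X k l) (v l)) \<in> \<real>\<^sub>\<ge>\<^sub>0)"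

definition completely_positive_on ::
    "'n::finite cmat set \<Rightarrow> ('n cmat \<Rightarrow> 'n cmat) \<Rightarrow> bool" where
  "completely_positive_on \<A> T \<longleftrightarrow>
     (\<forall>m X. (\<forall>k<m. \<forall>l<m. X k l \<in> \<A>) \<longrightarrow> block_pos m X \<longrightarrow> block_pos m (\<lambda>k l. T (X k l)))"

definition qms :: "'n::finite cmat set \<Rightarrow> (real \<Rightarrow> 'n cmat \<Rightarrow> 'n cmat) \<Rightarrow> bool" where
  "qms \<A> P \<longleftrightarrow>
     (\<forall>t\<ge>0. linear_op_on \<A> (P t) \<and> completely_positive_on \<A> (P t) \<and> P t (mat 1) = mat 1)
     \<and> (\<forall>A\<in>\<A>. P 0 A = A)
     \<and> (\<forall>s\<ge>0. \<forall>t\<ge>0. \<forall>A\<in>\<A>. P (s + t) A = P s (P t A))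
     \<and> (\<forall>A\<in>\<A>. continuous_on {0..} (\<lambda>t. P t A))"

text \<open>\<open>P t = exp (t L)\<close> on \<open>\<A>\<close>, as a convergent power series.\<close>

definition exp_semigroup ::
    "'n::finite cmat set \<Rightarrow> ('n cmat \<Rightarrow> 'n cmat) \<Rightarrow> (real \<Rightarrow> 'n cmat \<Rightarrow> 'n cmat) \<Rightarrow> bool" where
  "exp_semigroup \<A> L P \<longleftrightarrow> linear_op_on \<A> L
     \<and> (\<forall>t\<ge>0. \<forall>A\<in>\<A>. (\<lambda>k. (t ^ k / fact k) *\<^sub>R (L ^^ k) A) sums P t A)"

definition ergodic :: "'n::finite cmat set \<Rightarrow> (real \<Rightarrow> 'n cmat \<Rightarrow> 'n cmat) \<Rightarrow> bool" where
  "ergodic \<A> P \<longleftrightarrow> (\<forall>t>0. {A \<in> \<A>. P t A = A} = range mat)"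

definition detailed_balance ::
    "'n::finite cmat set \<Rightarrow> 'n cmat \<Rightarrow> (real \<Rightarrow> 'n cmat \<Rightarrow> 'n cmat) \<Rightarrow> bool" where
  "detailed_balance \<A> \<sigma> P \<longleftrightarrow>
     (\<forall>t>0. \<forall>A\<in>\<A>. \<forall>B\<in>\<A>. trace (\<sigma> ** cadj (P t A) ** B) = trace (\<sigma> ** cadj A ** P t B))"

definition dagger :: "'n::finite cmat set \<Rightarrow> ('n cmat \<Rightarrow> 'n cmat) \<Rightarrow> 'n cmat \<Rightarrow> 'n cmat" where
  "dagger \<A> T A = (THE B. B \<in> \<A> \<and> (\<forall>C\<in>\<A>. inner_H B C = inner_H A (T C)))"

definition modular_op :: "'n cmat \<Rightarrow> 'n cmat \<Rightarrow> 'n::finite cmat" where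
  "modular_op \<sigma> A = \<sigma> ** A ** matrix_inv \<sigma>"

definition standard_form :: "'n::finite cmat set \<Rightarrow> 'n cmat \<Rightarrow> ('n cmat \<Rightarrow> 'n cmat)
    \<Rightarrow> 'j set \<Rightarrow> ('j \<Rightarrow> 'n cmat) \<Rightarrow> ('j \<Rightarrow> real) \<Rightarrow> bool" where
  "standard_form \<A> \<sigma> L J V \<omega> \<longleftrightarrow> finite J
     \<and> (\<forall>j\<in>J. \<forall>k\<in>J. tau (cadj (V j) ** V k) = (if j = k then 1 else 0))
     \<and> (\<forall>j\<in>J. tau (V j) = 0)
     \<and> V ` J = (\<lambda>j. cadj (V j)) ` J
     \<and> (\<forall>j\<in>J. modular_op \<sigma> (V j) = exp (- \<omega> j) *\<^sub>R V j)
     \<and> (\<forall>A\<in>\<A>. L A = (\<Sum>j\<in>J. exp (- \<omega> j / 2) *\<^sub>R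
            (cadj (V j) ** commutator A (V j) + commutator (cadj (V j)) A ** V j)))"

text \<open>Differential calculus. The \<open>V j\<close> need not belong to \<open>\<A>\<close>, so vector fields have their
  components in the full matrix algebra.\<close>

definition nabla :: "'j set \<Rightarrow> ('j \<Rightarrow> 'n cmat) \<Rightarrow> 'n::finite cmat \<Rightarrow> 'j \<Rightarrow> 'n cmat" where
  "nabla J V A = (\<lambda>j\<in>J. commutator (V j) A)"

definition divergence :: "'j set \<Rightarrow> ('j \<Rightarrow> 'n cmat) \<Rightarrow> ('j \<Rightarrow> 'n cmat) \<Rightarrow> 'n::finite cmat" where
  "divergence J V W = (\<Sum>j\<in>J. commutator (W j) (cadj (V j)))"

definition weight_op :: "'n cmat \<Rightarrow> real \<Rightarrow> 'n cmat \<Rightarrow> 'n::finite cmat" where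
  "weight_op \<rho> w A =
     integral {0..1} (\<lambda>s. exp (w * (s - 1/2)) *\<^sub>R (mat_powr \<rho> s ** A ** mat_powr \<rho> (1 - s)))"

definition vf_inner :: "'j set \<Rightarrow> ('j \<Rightarrow> real) \<Rightarrow> 'n::finite cmat
    \<Rightarrow> ('j \<Rightarrow> 'n cmat) \<Rightarrow> ('j \<Rightarrow> 'n cmat) \<Rightarrow> complex" where
  "vf_inner J \<omega> \<rho> W X = (\<Sum>j\<in>J. inner_H (W j) (weight_op \<rho> (\<omega> j) (X j)))"

text \<open>The vector field \<open>\<nabla>U\<close>, with \<open>U\<close> self-adjoint in \<open>\<A>\<close>, that corresponds to the tangent
  vector \<open>X\<close> at \<open>\<rho>\<close>.\<close>

definition tangent_field :: "'n::finite cmat set \<Rightarrow> 'j set \<Rightarrow> ('j \<Rightarrow> 'n cmat) \<Rightarrow> ('j \<Rightarrow> real)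
    \<Rightarrow> 'n cmat \<Rightarrow> 'n cmat \<Rightarrow> 'j \<Rightarrow> 'n cmat" where
  "tangent_field \<A> J V \<omega> \<rho> X = (THE W. \<exists>U\<in>\<A>. cadj U = U \<and> W = nabla J V U
      \<and> X = - divergence J V (\<lambda>j. weight_op \<rho> (\<omega> j) (W j)))"

text \<open>The real bilinear form obtained from the squared norm \<open>\<parallel>X\<parallel>\<^sup>2 = \<parallel>\<nabla>U\<parallel>\<^sup>2\<close> by polarization.
  Pitfall: this uses the normalized trace \<open>tau\<close>, whereas \<open>inv_densities\<close> and \<open>rel_entropy\<close> use the
  unnormalized trace \<open>Tr\<close>. The gradient of \<open>rel_entropy\<close> for \<open>metric_L\<close> is therefore \<open>Tr 1\<close> times its
  gradient for the metric built from \<open>Tr[A\<^sup>* B]\<close>, which is \<open>Tr 1 \<cdot> metric_L\<close>.\<close>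

definition metric_L :: "'n::finite cmat set \<Rightarrow> 'j set \<Rightarrow> ('j \<Rightarrow> 'n cmat) \<Rightarrow> ('j \<Rightarrow> real)
    \<Rightarrow> 'n cmat \<Rightarrow> 'n cmat \<Rightarrow> 'n cmat \<Rightarrow> real" where
  "metric_L \<A> J V \<omega> \<rho> X Y =
     Re (vf_inner J \<omega> \<rho> (tangent_field \<A> J V \<omega> \<rho> X) (tangent_field \<A> J V \<omega> \<rho> Y))"

text \<open>Riemannian gradients for a metric \<open>g\<close> on a set \<open>S\<close>, tangent vectors being velocities of
  differentiable paths in \<open>S\<close>. The gradient is characterized by
  \<open>d/dt F(\<gamma>(t)) = g (grad F) \<gamma>'\<close>.\<close>

definition path_velocity :: "'a::real_normed_vector set \<Rightarrow> 'a \<Rightarrow> (real \<Rightarrow> 'a) \<Rightarrow> 'a \<Rightarrow> bool" where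
  "path_velocity S p \<gamma> X \<longleftrightarrow> \<gamma> 0 = p
     \<and> (\<exists>\<epsilon>>0. \<forall>t. \<bar>t\<bar> < \<epsilon> \<longrightarrow> \<gamma> t \<in> S \<and> \<gamma> differentiable (at t))
     \<and> (\<gamma> has_vector_derivative X) (at 0)"

definition tangent_space :: "'a::real_normed_vector set \<Rightarrow> 'a \<Rightarrow> 'a set" where
  "tangent_space S p = {X. \<exists>\<gamma>. path_velocity S p \<gamma> X}"

definition riemannian_gradient :: "'a::real_normed_vector set \<Rightarrow> ('a \<Rightarrow> 'a \<Rightarrow> 'a \<Rightarrow> real)
    \<Rightarrow> ('a \<Rightarrow> real) \<Rightarrow> 'a \<Rightarrow> 'a \<Rightarrow> bool" where
  "riemannian_gradient S g F p G \<longleftrightarrow> G \<in> tangent_space S p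
     \<and> (\<forall>\<gamma> X. path_velocity S p \<gamma> X \<longrightarrow> ((\<lambda>t. F (\<gamma> t)) has_real_derivative g p G X) (at 0))"

text \<open>The differential equation \<open>p' = Z p\<close> on \<open>S\<close> is the steepest descent flow of \<open>F\<close>.\<close>

definition gradient_flow :: "'a::real_normed_vector set \<Rightarrow> ('a \<Rightarrow> 'a \<Rightarrow> 'a \<Rightarrow> real)
    \<Rightarrow> ('a \<Rightarrow> real) \<Rightarrow> ('a \<Rightarrow> 'a) \<Rightarrow> bool" where
  "gradient_flow S g F Z \<longleftrightarrow> (\<forall>p\<in>S. \<exists>G. riemannian_gradient S g F p G \<and> Z p = - G)"

end

theory Submission
  imports Defs
begin

text \<open>Put \<open>U = ln \<rho> - ln \<sigma>\<close>. Along paths in the state space the entropy has differential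
  \<open>X \<mapsto> Re Tr(X U)\<close>: the difference \<open>D(\<gamma> t || \<sigma>) - D(\<gamma> t || \<rho>)\<close> is linear in \<open>\<gamma> t\<close>, while
  \<open>D(\<gamma> t || \<rho>)\<close> lies between \<open>0\<close> and \<open>Tr((\<gamma> t - \<rho>)\<^sup>2 \<rho>\<^sup>-\<^sup>1)\<close>, which is of second order, so the
  continuity of the matrix logarithm is never needed.
  Since \<open>[V j, ln \<sigma>] = \<omega> j V j\<close>, the fundamental theorem of calculus gives
  \<open>[\<rho>]\<^sub>\<omega> (\<partial>\<^sub>j U) = e\<^sup>-\<^sup>\<omega>\<^sup>/\<^sup>2 V j \<rho> - e\<^sup>\<omega>\<^sup>/\<^sup>2 \<rho> V j\<close>, and the divergence of this vector field is the adjoint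
  generator applied to \<open>\<rho>\<close>; so \<open>\<nabla>U\<close> is the field representing the gradient.

  The \<open>V j\<close> need not lie in \<open>\<A>\<close>, so it has to be shown that the divergences stay in \<open>\<A>\<close>. The carre
  du champ of the generator takes values in \<open>\<A>\<close>, and the weights \<open>e\<^sup>s\<^sup>\<omega>\<close> can be changed by conjugating
  with powers of \<open>\<sigma>\<close>, which lie in \<open>\<A>\<close>; this suffices. That every traceless selfadjoint element is
  a divergence then follows from ergodicity by orthogonality.\<close>

subsection \<open>Matrix algebra\<close>

lemma cadj_component [simp]: "cadj A $ i $ j = cnj (A $ j $ i)"
  by (simp add: cadj_def)

lemma cadj_cadj [simp]: "cadj (cadj A) = A"
  by (simp add: vec_eq_iff)

lemma cadj_mult: "cadj (A ** B) = cadj B ** cadj A"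
  by (simp add: vec_eq_iff matrix_matrix_mult_def mult.commute)

lemma cadj_mat [simp]: "cadj (mat c) = mat (cnj c)"
  by (auto simp: vec_eq_iff mat_def)

lemma bounded_linear_cadj: "bounded_linear (cadj :: 'n::finite cmat \<Rightarrow> 'n cmat)"
  unfolding linear_conv_bounded_linear[symmetric]
  by (rule linearI) (auto simp: vec_eq_iff complex_eq_iff)

lemmas cadj_add = bounded_linear.linear[OF bounded_linear_cadj, THEN linear_add]
lemmas cadj_diff = bounded_linear.linear[OF bounded_linear_cadj, THEN linear_diff]
lemmas cadj_minus = bounded_linear.linear[OF bounded_linear_cadj, THEN linear_neg]
lemmas cadj_sum = bounded_linear.linear[OF bounded_linear_cadj, THEN linear_sum]
lemmas cadj_scaleR = bounded_linear.linear[OF bounded_linear_cadj, THEN linear_cmul]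
lemmas cadj_0 [simp] = bounded_linear.linear[OF bounded_linear_cadj, THEN linear_0]

lemma bounded_bilinear_matrix_mult:
  "bounded_bilinear ((**) :: 'n::finite cmat \<Rightarrow> 'n cmat \<Rightarrow> 'n cmat)"
  unfolding bilinear_conv_bounded_bilinear[symmetric] bilinear_def
  by (auto intro!: linearI
      simp: vec_eq_iff matrix_matrix_mult_def algebra_simps sum.distrib scaleR_sum_right)

interpretation mm: bounded_bilinear "(**) :: 'n::finite cmat \<Rightarrow> 'n cmat \<Rightarrow> 'n cmat"
  by (rule bounded_bilinear_matrix_mult)

lemma bounded_linear_trace: "bounded_linear (trace :: 'n::finite cmat \<Rightarrow> complex)"
  unfolding linear_conv_bounded_linear[symmetric]
  by (rule linearI) (auto simp: trace_def sum.distrib scaleR_sum_right)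

lemmas trace_sum = bounded_linear.linear[OF bounded_linear_trace, THEN linear_sum]
lemmas trace_minus = bounded_linear.linear[OF bounded_linear_trace, THEN linear_neg]
lemmas trace_scaleR = bounded_linear.linear[OF bounded_linear_trace, THEN linear_cmul]

lemma mat_mult_eq_scaleR: "mat (complex_of_real r) ** A = r *\<^sub>R A"
  by (simp add: vec_eq_iff matrix_matrix_mult_def mat_def if_distrib[of "\<lambda>x. x * _"] cong: if_cong)
     (simp add: scaleR_conv_of_real)

text \<open>Identifies the Euclidean inner product of the type with the real part of the trace form.
  Selfadjoint elements form only a real subspace, so this real form carries the orthogonality
  arguments.\<close>

lemma inner_eq_trace: "inner A B = Re (trace (cadj A ** B))"
proof -
  have "inner A B = (\<Sum>j\<in>UNIV. \<Sum>i\<in>UNIV. inner (A $ j $ i) (B $ j $ i))"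
    by (simp add: inner_vec_def)
  also have "\<dots> = (\<Sum>i\<in>UNIV. \<Sum>j\<in>UNIV. inner (A $ j $ i) (B $ j $ i))"
    by (rule sum.swap)
  also have "\<dots> = Re (trace (cadj A ** B))"
    by (simp add: trace_def matrix_matrix_mult_def inner_complex_def)
  finally show ?thesis .
qed

lemma inner_H_eq: "inner_H A B = trace (cadj A ** B) / of_nat CARD('n)" for A B :: "'n::finite cmat"
  by (simp add: inner_H_def tau_def trace_I)

subsection \<open>Spectral theorem\<close>

definition hdot :: "complex^'n::finite \<Rightarrow> complex^'n \<Rightarrow> complex" where
  "hdot v w = (\<Sum>i\<in>UNIV. cnj (v $ i) * w $ i)"

lemma sesq_eq_hdot: "sesq v A w = hdot v (A *v w)"
  by (simp add: sesq_def hdot_def)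

lemma inner_eq_Re_hdot: "inner v w = Re (hdot v w)"
  by (simp add: inner_vec_def hdot_def inner_complex_def)

lemma hdot_cadj: "hdot v (A *v w) = hdot (cadj A *v v) w"
proof -
  have "hdot v (A *v w) = (\<Sum>i\<in>UNIV. \<Sum>j\<in>UNIV. cnj (v $ i) * A $ i $ j * w $ j)"
    by (simp add: hdot_def matrix_vector_mult_def sum_distrib_left mult.assoc)
  also have "\<dots> = (\<Sum>j\<in>UNIV. \<Sum>i\<in>UNIV. cnj (v $ i) * A $ i $ j * w $ j)"
    by (rule sum.swap)
  also have "\<dots> = hdot (cadj A *v v) w"
    by (simp add: hdot_def matrix_vector_mult_def sum_distrib_left sum_distrib_right mult_ac)
  finally show ?thesis .
qed

lemma hdot_commute: "hdot v w = cnj (hdot w v)"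
  by (simp add: hdot_def mult.commute)

lemma hdot_add_right: "hdot u (v + w) = hdot u v + hdot u w"
  by (simp add: hdot_def algebra_simps sum.distrib)

lemma hdot_scaleR_right: "hdot u (r *\<^sub>R v) = r *\<^sub>R hdot u v"
  by (simp add: hdot_def scaleR_sum_right)

lemma hdot_self: "hdot v v = complex_of_real ((norm v)\<^sup>2)"
proof -
  have "Im (hdot v v) = 0" by (simp add: hdot_def mult.commute)
  moreover have "Re (hdot v v) = (norm v)\<^sup>2"
    by (metis inner_eq_Re_hdot dot_square_norm)
  ultimately show ?thesis by (simp add: complex_eq_iff)
qed

lemma matrix_vector_mult_scaleR_complex:
  "A *v (r *\<^sub>R v) = r *\<^sub>R (A *v v)" for A :: "'n::finite cmat"
  by (rule linear_cmul[OF matrix_vector_mul_linear])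

text \<open>A maximizer of the Rayleigh quotient on an invariant subspace is an eigenvector.\<close>

lemma hermitian_eigenvector_in_subspace:
  fixes A :: "'n::finite cmat" and S :: "(complex^'n) set"
  assumes herm: "cadj A = A" and S: "subspace S" and inv: "\<And>v. v \<in> S \<Longrightarrow> A *v v \<in> S"
    and ne: "x \<in> S" "x \<noteq> 0"
  obtains v l where "v \<in> S" "norm v = 1" "A *v v = l *\<^sub>R v"
proof -
  let ?q = "\<lambda>v. inner v (A *v v)"
  let ?K = "sphere 0 1 \<inter> S"
  have sym: "inner v (A *v w) = inner (A *v v) w" for v w
    by (simp add: inner_eq_Re_hdot hdot_cadj herm)
  have "compact ?K"
    by (intro compact_Int_closed compact_sphere closed_subspace S)
  moreover have "(1 / norm x) *\<^sub>R x \<in> ?K"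
    using ne S by (auto simp: subspace_scale)
  moreover have "continuous_on ?K ?q"
    by (intro continuous_intros linear_continuous_on matrix_vector_mul_bounded_linear)
  ultimately obtain v where v: "v \<in> ?K" and max: "\<And>y. y \<in> ?K \<Longrightarrow> ?q y \<le> ?q v"
    using continuous_attains_sup[of ?K ?q] by blast
  define l where "l = ?q v"
  have nv: "norm v = 1" "v \<in> S" using v by auto
  have bound: "?q y \<le> l * (norm y)\<^sup>2" if "y \<in> S" for y
  proof (cases "y = 0")
    case False
    have "(1 / norm y) *\<^sub>R y \<in> ?K" using that False S by (auto simp: subspace_scale)
    from max[OF this] have "?q y / (norm y)\<^sup>2 \<le> l"
      by (simp add: l_def matrix_vector_mult_scaleR_complex power2_eq_square)
    then show ?thesis using False by (simp add: field_simps)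
  qed simp
  \<comment> \<open>The residual \<open>w\<close> serves as test direction: comparing
    \<open>v + t *\<^sub>R w\<close> with \<open>bound\<close> leaves
    \<open>2 * t * inner w w\<close> at first order in \<open>t\<close>, so maximality forces
    \<open>w = 0\<close>.\<close>
  define w where "w = A *v v - l *\<^sub>R v"
  have w: "w \<in> S" unfolding w_def using S inv nv by (simp add: subspace_diff subspace_scale)
  define c where "c = ?q w - l * (norm w)\<^sup>2"
  have vv: "inner v v = 1" using nv by (simp add: dot_square_norm)
  have ww: "inner w w = inner w (A *v v) - l * inner w v"
    by (metis (no_types) inner_diff_right inner_scaleR_right w_def)
  have expand: "2 * t * inner w w + t\<^sup>2 * c \<le> 0" for t
  proof -
    have mem: "v + t *\<^sub>R w \<in> S" using S nv w by (simp add: subspace_add subspace_scale)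
    have "inner v (A *v w) = inner w (A *v v)" by (metis sym inner_commute)
    then have "?q (v + t *\<^sub>R w) = l + 2 * t * inner w (A *v v) + t\<^sup>2 * ?q w"
      unfolding l_def matrix_vector_right_distrib matrix_vector_mult_scaleR_complex
        inner_add_left inner_add_right inner_scaleR_left inner_scaleR_right power2_eq_square
      by (simp only:) (simp add: algebra_simps)
    moreover have "(norm (v + t *\<^sub>R w))\<^sup>2 = 1 + 2 * t * inner w v + t\<^sup>2 * (norm w)\<^sup>2"
      unfolding power2_norm_eq_inner inner_add_left inner_add_right inner_scaleR_left
        inner_scaleR_right vv inner_commute[of v w]
      unfolding power2_eq_square by (simp only: algebra_simps)
    ultimately have "l + 2 * t * inner w (A *v v) + t\<^sup>2 * ?q w
        \<le> l * (1 + 2 * t * inner w v + t\<^sup>2 * (norm w)\<^sup>2)"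
      using bound[OF mem] by simp
    then show ?thesis unfolding ww c_def by (simp add: algebra_simps)
  qed
  have "inner w w \<le> 0"
  proof (rule ccontr)
    assume "\<not> inner w w \<le> 0"
    then have pos: "inner w w > 0" by (simp only: not_le)
    \<comment> \<open>This choice gives \<open>t * \<bar>c\<bar> < inner w w\<close>, so the
      quadratic term cannot offset \<open>2 * inner w w\<close>.\<close>
    define t where "t = inner w w / (\<bar>c\<bar> + 1)"
    have t: "t > 0" using pos by (simp add: t_def)
    have "t * (2 * inner w w + t * c) \<le> 0"
      using expand[of t] by (simp add: algebra_simps power2_eq_square)
    then have "2 * inner w w + t * c \<le> 0"
      using t by (simp add: mult_le_0_iff)
    moreover have "t * (\<bar>c\<bar> + 1) = inner w w" by (simp add: t_def)
    moreover have "- (t * c) \<le> t * \<bar>c\<bar>" using t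
      by (metis abs_ge_minus_self less_imp_le mult_left_mono mult_minus_right)
    ultimately show False using t pos by (simp add: algebra_simps)
  qed
  then have "w = 0" by (metis inner_ge_zero inner_eq_zero_iff antisym)
  then have "A *v v = l *\<^sub>R v" by (simp add: w_def)
  with nv that show ?thesis by blast
qed

text \<open>The rows of \<open>M\<close> with index outside \<open>I\<close> vanish, so
  \<open>M\<close> is singular and has a nonzero kernel vector. Indexing the vectors by the matrix
  index type replaces a dimension count.\<close>

lemma exists_orthogonal_vector:
  fixes u :: "'n::finite \<Rightarrow> complex^'n"
  assumes "k \<notin> I"
  shows "\<exists>x. x \<noteq> 0 \<and> (\<forall>i\<in>I. hdot (u i) x = 0)"
proof -
  define M :: "'n cmat" where "M = (\<chi> i j. if i \<in> I then cnj (u i $ j) else 0)"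
  have "\<not> (\<exists>B. B ** M = mat 1)"
  proof
    assume "\<exists>B. B ** M = mat 1"
    then obtain B where "M ** B = mat 1" using matrix_left_right_inverse by blast
    then have "(M ** B) $ k $ k = (1::complex)" by (simp add: mat_def)
    then show False using assms by (simp add: M_def matrix_matrix_mult_def)
  qed
  then obtain x where x: "x \<noteq> 0" "M *v x = 0"
    using matrix_left_invertible_ker[of M] by auto
  have "hdot (u i) x = 0" if "i \<in> I" for i
  proof -
    have "hdot (u i) x = (M *v x) $ i"
      using that by (simp add: M_def hdot_def matrix_vector_mult_def)
    then show ?thesis using x by simp
  qed
  with x show ?thesis by blast
qed

text \<open>Induction on the index set: the orthogonal complement of the eigenvectors found so far
  is invariant because \<open>A\<close> is selfadjoint, and it is nonzero as long as an index
  remains.\<close>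

lemma hermitian_orthonormal_eigenvectors:
  fixes A :: "'n::finite cmat" and I :: "'n set"
  assumes herm: "cadj A = A"
  shows "\<exists>u d. (\<forall>i\<in>I. A *v u i = d i *\<^sub>R u i) \<and>
    (\<forall>i\<in>I. \<forall>j\<in>I. hdot (u i) (u j) = (if i = j then 1 else 0))"
using finite[of I] proof (induction I rule: finite_induct)
  case empty
  show ?case by simp
next
  case (insert k I)
  then obtain u d where "(\<forall>i\<in>I. A *v u i = d i *\<^sub>R u i) \<and>
      (\<forall>i\<in>I. \<forall>j\<in>I. hdot (u i) (u j) = (if i = j then 1 else 0))" by (elim exE)
  then have u: "\<And>i. i \<in> I \<Longrightarrow> A *v u i = d i *\<^sub>R u i"
    "\<And>i j. i \<in> I \<Longrightarrow> j \<in> I \<Longrightarrow> hdot (u i) (u j) = (if i = j then 1 else 0)"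
    by auto
  define S where "S = {x. \<forall>i\<in>I. hdot (u i) x = 0}"
  have S: "subspace S"
    by (auto simp: S_def subspace_def hdot_add_right hdot_scaleR_right) (simp add: hdot_def)
  have inv: "A *v v \<in> S" if "v \<in> S" for v
  proof -
    have "hdot (u i) (A *v v) = 0" if i: "i \<in> I" for i
    proof -
      have "hdot (u i) (A *v v) = hdot (d i *\<^sub>R u i) v"
        unfolding hdot_cadj herm u(1)[OF i] ..
      also have "\<dots> = d i *\<^sub>R hdot (u i) v"
        by (simp add: hdot_def scaleR_sum_right)
      finally show ?thesis using \<open>v \<in> S\<close> i by (simp add: S_def)
    qed
    then show ?thesis by (simp add: S_def)
  qed
  obtain x where x: "x \<in> S" "x \<noteq> 0"
    using exists_orthogonal_vector[OF insert.hyps(2), of u] by (auto simp: S_def)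
  obtain v l where v: "v \<in> S" "norm v = 1" "A *v v = l *\<^sub>R v"
    by (rule hermitian_eigenvector_in_subspace[OF herm S inv x])
  have o: "hdot (u i) v = 0" "hdot v (u i) = 0" if "i \<in> I" for i
    using v(1) that by (simp_all add: S_def hdot_commute[of v "u i"])
  have "hdot v v = 1" using v(2) by (simp add: hdot_self)
  then have "(\<forall>i\<in>insert k I. A *v (u(k := v)) i = (d(k := l)) i *\<^sub>R (u(k := v)) i) \<and>
    (\<forall>i\<in>insert k I. \<forall>j\<in>insert k I.
       hdot ((u(k := v)) i) ((u(k := v)) j) = (if i = j then 1 else 0))"
    using v(3) u o insert.hyps(2) by auto
  then show ?case by (intro exI)
qed

lemma hermitian_diagonalization:
  fixes A :: "'n::finite cmat"
  assumes herm: "cadj A = A"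
  obtains U d where "unitary_mat U" "A = U ** real_diag d ** cadj U"
proof -
  obtain u :: "'n \<Rightarrow> complex^'n" and d where "(\<forall>i\<in>UNIV. A *v u i = d i *\<^sub>R u i) \<and>
      (\<forall>i\<in>UNIV. \<forall>j\<in>UNIV. hdot (u i) (u j) = (if i = j then 1 else 0))"
    using hermitian_orthonormal_eigenvectors[OF herm, of UNIV] by (elim exE)
  then have u: "\<And>i. A *v u i = d i *\<^sub>R u i"
    "\<And>i j. hdot (u i) (u j) = (if i = j then 1 else 0)"
    by simp_all
  define U :: "'n cmat" where "U = (\<chi> a i. u i $ a)"
  have 1: "cadj U ** U = mat 1"
    using u(2) by (simp add: vec_eq_iff matrix_matrix_mult_def mat_def U_def hdot_def)
  then have 2: "U ** cadj U = mat 1" using matrix_left_right_inverse by blast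
  have "(A ** U) $ a $ i = (U ** real_diag d) $ a $ i" for a i
  proof -
    have "(A ** U) $ a $ i = (A *v u i) $ a"
      by (simp add: matrix_matrix_mult_def matrix_vector_mult_def U_def)
    also have "\<dots> = (U ** real_diag d) $ a $ i"
      by (simp add: u(1) matrix_matrix_mult_def real_diag_def U_def if_distrib[of "\<lambda>x. _ * x"] cong: if_cong)
         (simp add: scaleR_conv_of_real mult.commute)
    finally show ?thesis .
  qed
  then have "A ** U = U ** real_diag d" by (simp add: vec_eq_iff)
  then have "U ** real_diag d ** cadj U = A ** (U ** cadj U)"
    by (simp add: matrix_mul_assoc)
  then have "A = U ** real_diag d ** cadj U" using 2 by simp
  with 1 2 that show ?thesis by (simp add: unitary_mat_def)
qed

subsection \<open>Functional calculus\<close>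

lemma real_diag_mult: "real_diag f ** real_diag g = real_diag (\<lambda>i. f i * g i)"
  by (auto simp: vec_eq_iff matrix_matrix_mult_def real_diag_def if_distrib[of "\<lambda>x. x * _"]
      cong: if_cong)

lemma real_diag_const: "real_diag (\<lambda>i. c) = mat (complex_of_real c)"
  by (simp add: vec_eq_iff real_diag_def mat_def)

lemma cadj_real_diag [simp]: "cadj (real_diag d) = real_diag d"
  by (auto simp: vec_eq_iff real_diag_def)

text \<open>Shows that the definite description in \<open>mat_fun\<close> is well defined. For two
  diagonalizations the matrix \<open>M = cadj U' ** U\<close> intertwines the diagonals, so
  \<open>M $ i $ j\<close> can be nonzero only where \<open>d j = d' i\<close>, and there
  \<open>f\<close> takes equal values.\<close>

lemma mat_fun_diag:
  fixes U :: "'n::finite cmat"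
  assumes U: "unitary_mat U"
  shows "mat_fun f (U ** real_diag d ** cadj U) = U ** real_diag (f \<circ> d) ** cadj U"
proof -
  have uniq: "U' ** real_diag (f \<circ> d') ** cadj U' = U ** real_diag (f \<circ> d) ** cadj U"
    if U': "unitary_mat U'" and eq: "U ** real_diag d ** cadj U = U' ** real_diag d' ** cadj U'" for U' d'
  proof -
    define M where "M = cadj U' ** U"
    have UU: "cadj U ** U = mat 1" "U ** cadj U = mat 1" "cadj U' ** U' = mat 1" "U' ** cadj U' = mat 1"
      using U U' by (simp_all add: unitary_mat_def)
    have "M ** real_diag d = cadj U' ** (U ** real_diag d ** cadj U) ** U"
      unfolding M_def by (simp add: UU flip: matrix_mul_assoc)
    also have "\<dots> = (cadj U' ** U') ** real_diag d' ** (cadj U' ** U)"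
      unfolding eq by (simp only: matrix_mul_assoc)
    also have "\<dots> = real_diag d' ** M" by (simp add: UU M_def)
    finally have c: "M ** real_diag d = real_diag d' ** M" .
    have "(M ** real_diag (f \<circ> d)) $ i $ j = (real_diag (f \<circ> d') ** M) $ i $ j" for i j
    proof -
      have "(M ** real_diag d) $ i $ j = (real_diag d' ** M) $ i $ j" by (simp add: c)
      then have "M $ i $ j * d j = d' i * M $ i $ j"
        by (simp add: matrix_matrix_mult_def real_diag_def if_distrib[of "\<lambda>x. _ * x"]
            if_distrib[of "\<lambda>x. x * _"] cong: if_cong)
      then have "M $ i $ j = 0 \<or> d j = d' i" by (simp add: mult.commute)
      then have "M $ i $ j * f (d j) = f (d' i) * M $ i $ j" by auto
      then show ?thesis
        by (simp add: matrix_matrix_mult_def real_diag_def if_distrib[of "\<lambda>x. _ * x"]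
            if_distrib[of "\<lambda>x. x * _"] cong: if_cong)
    qed
    then have c: "M ** real_diag (f \<circ> d) = real_diag (f \<circ> d') ** M" by (simp add: vec_eq_iff)
    have "U' ** real_diag (f \<circ> d') ** cadj U' = U' ** (real_diag (f \<circ> d') ** M) ** cadj U"
      unfolding M_def by (simp add: UU flip: matrix_mul_assoc)
    also have "\<dots> = (U' ** cadj U') ** U ** real_diag (f \<circ> d) ** cadj U"
      unfolding c[symmetric] unfolding M_def by (simp only: matrix_mul_assoc)
    also have "\<dots> = U ** real_diag (f \<circ> d) ** cadj U" by (simp add: UU)
    finally show ?thesis .
  qed
  show ?thesis
    unfolding mat_fun_def
  proof (rule the_equality)
    show "\<exists>U' d'. unitary_mat U' \<and> U ** real_diag d ** cadj U = U' ** real_diag d' ** cadj U' \<and>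
       U ** real_diag (f \<circ> d) ** cadj U = U' ** real_diag (f \<circ> d') ** cadj U'"
      using U by blast
  next
    fix B
    assume "\<exists>U' d'. unitary_mat U' \<and> U ** real_diag d ** cadj U = U' ** real_diag d' ** cadj U' \<and>
       B = U' ** real_diag (f \<circ> d') ** cadj U'"
    then show "B = U ** real_diag (f \<circ> d) ** cadj U" using uniq by metis
  qed
qed

lemma mat_fun_mult:
  assumes "cadj A = A"
  shows "mat_fun f A ** mat_fun g A = mat_fun (\<lambda>x. f x * g x) A"
proof -
  obtain U d where U: "unitary_mat U" and A: "A = U ** real_diag d ** cadj U"
    by (rule hermitian_diagonalization[OF assms])
  have "mat_fun f A ** mat_fun g A
      = U ** real_diag (f \<circ> d) ** (cadj U ** U) ** real_diag (g \<circ> d) ** cadj U"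
    unfolding A mat_fun_diag[OF U] by (simp only: matrix_mul_assoc)
  also have "\<dots> = U ** (real_diag (f \<circ> d) ** real_diag (g \<circ> d)) ** cadj U"
    using U by (simp add: unitary_mat_def matrix_mul_assoc)
  also have "\<dots> = mat_fun (\<lambda>x. f x * g x) A"
    unfolding A mat_fun_diag[OF U] by (simp add: real_diag_mult o_def)
  finally show ?thesis .
qed

lemma mat_fun_add:
  assumes "cadj A = A"
  shows "mat_fun f A + mat_fun g A = mat_fun (\<lambda>x. f x + g x) A"
proof -
  obtain U d where U: "unitary_mat U" and A: "A = U ** real_diag d ** cadj U"
    by (rule hermitian_diagonalization[OF assms])
  have "real_diag (\<lambda>i. f (d i) + g (d i)) = real_diag (\<lambda>i. f (d i)) + real_diag (\<lambda>i. g (d i))"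
    by (simp add: vec_eq_iff real_diag_def)
  then show ?thesis
    unfolding A mat_fun_diag[OF U] by (simp add: o_def mm.add_left mm.add_right)
qed

lemma mat_fun_const:
  fixes A :: "'n::finite cmat"
  assumes "cadj A = A"
  shows "mat_fun (\<lambda>x. c) A = c *\<^sub>R mat 1"
proof -
  obtain U d where U: "unitary_mat U" and A: "A = U ** real_diag d ** cadj U"
    by (rule hermitian_diagonalization[OF assms])
  have "real_diag (\<lambda>i. c) = c *\<^sub>R (mat 1 :: 'n cmat)"
    using mat_mult_eq_scaleR[of c "mat 1"] by (simp add: real_diag_const)
  then show ?thesis
    using U unfolding A mat_fun_diag[OF U]
    by (simp add: o_def mm.scaleR_left mm.scaleR_right unitary_mat_def)
qed

lemma mat_fun_ident:
  assumes "cadj A = A"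
  shows "mat_fun (\<lambda>x. x) A = A"
proof -
  obtain U d where U: "unitary_mat U" and A: "A = U ** real_diag d ** cadj U"
    by (rule hermitian_diagonalization[OF assms])
  then show ?thesis by (simp add: mat_fun_diag[OF U] o_def)
qed

lemma cadj_mat_fun:
  assumes "cadj A = A"
  shows "cadj (mat_fun f A) = mat_fun f A"
proof -
  obtain U d where U: "unitary_mat U" and A: "A = U ** real_diag d ** cadj U"
    by (rule hermitian_diagonalization[OF assms])
  then show ?thesis by (simp add: mat_fun_diag[OF U] cadj_mult matrix_mul_assoc)
qed

lemma mat_fun_scaleR:
  assumes "cadj A = A"
  shows "c *\<^sub>R mat_fun f A = mat_fun (\<lambda>x. c * f x) A"
  using mat_fun_mult[OF assms, of "\<lambda>x. c" f] by (simp add: mat_fun_const[OF assms] mm.scaleR_left)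

lemma mat_fun_sum:
  assumes "cadj A = A" "finite I"
  shows "(\<Sum>i\<in>I. mat_fun (f i) A) = mat_fun (\<lambda>x. \<Sum>i\<in>I. f i x) A"
  using assms(2)
proof (induction I rule: finite_induct)
  case empty
  then show ?case by (simp add: mat_fun_const[OF assms(1)])
next
  case (insert i I)
  then show ?case by (simp add: mat_fun_add[OF assms(1)])
qed

section \<open>Spectral projections and the spectral resolution\<close>

text \<open>For selfadjoint \<open>A\<close> this is the orthogonal projection onto the eigenspace
  of \<open>x\<close>. It is zero exactly when \<open>x\<close> is not an eigenvalue, which is the
  test used in \<open>eigvals\<close>.\<close>

definition spec_proj :: "'n::finite cmat \<Rightarrow> real \<Rightarrow> 'n cmat" where
  "spec_proj A x = mat_fun (\<lambda>y. if y = x then 1 else 0) A"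

definition eigvals :: "'n::finite cmat \<Rightarrow> real set" where
  "eigvals A = {x. spec_proj A x \<noteq> 0}"

lemma eigvals_diag:
  fixes U :: "'n::finite cmat"
  assumes U: "unitary_mat U"
  shows "eigvals (U ** real_diag d ** cadj U) = range d"
proof -
  have "spec_proj (U ** real_diag d ** cadj U) x = 0 \<longleftrightarrow> x \<notin> range d" for x
  proof -
    let ?D = "real_diag ((\<lambda>y. if y = x then 1 else 0) \<circ> d) :: 'n cmat"
    have "cadj U ** (U ** ?D ** cadj U) ** U = (cadj U ** U) ** ?D ** (cadj U ** U)"
      by (simp only: matrix_mul_assoc)
    then have "U ** ?D ** cadj U = 0 \<longleftrightarrow> ?D = 0"
      using U by (auto simp: unitary_mat_def mm.zero_left mm.zero_right)
    also have "\<dots> \<longleftrightarrow> x \<notin> range d"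
      by (auto simp: vec_eq_iff real_diag_def)
    finally show ?thesis unfolding spec_proj_def mat_fun_diag[OF U] .
  qed
  then show ?thesis by (auto simp: eigvals_def)
qed

lemma finite_eigvals:
  assumes "cadj A = A"
  shows "finite (eigvals A)"
proof -
  obtain U d where U: "unitary_mat U" and A: "A = U ** real_diag d ** cadj U"
    by (rule hermitian_diagonalization[OF assms])
  then show ?thesis by (simp add: eigvals_diag)
qed

lemma mat_fun_cong:
  assumes "cadj A = A" and eq: "\<And>x. x \<in> eigvals A \<Longrightarrow> f x = g x"
  shows "mat_fun f A = mat_fun g A"
proof -
  obtain U d where U: "unitary_mat U" and A: "A = U ** real_diag d ** cadj U"
    by (rule hermitian_diagonalization[OF assms(1)])
  have "f \<circ> d = g \<circ> d"
    using eq unfolding A eigvals_diag[OF U] by auto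
  then show ?thesis unfolding A mat_fun_diag[OF U] by simp
qed

text \<open>The spectral resolution; from here on matrix functions are handled block by block and no
  diagonalizing unitary appears again.\<close>

lemma mat_fun_eq_sum:
  assumes A: "cadj A = A"
  shows "mat_fun f A = (\<Sum>x\<in>eigvals A. f x *\<^sub>R spec_proj A x)"
proof -
  note fin = finite_eigvals[OF A]
  have "(\<Sum>x\<in>eigvals A. f x *\<^sub>R spec_proj A x)
      = mat_fun (\<lambda>y. \<Sum>x\<in>eigvals A. f x * (if y = x then 1 else 0)) A"
    unfolding spec_proj_def mat_fun_scaleR[OF A] mat_fun_sum[OF A fin] ..
  also have "\<dots> = mat_fun f A"
    by (rule mat_fun_cong[OF A]) (simp add: fin if_distrib cong: if_cong)
  finally show ?thesis ..
qed

lemma cadj_spec_proj: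
  assumes "cadj A = A"
  shows "cadj (spec_proj A x) = spec_proj A x"
  unfolding spec_proj_def by (rule cadj_mat_fun[OF assms])

lemma spec_proj_mult:
  assumes A: "cadj A = A"
  shows "spec_proj A x ** spec_proj A y = (if x = y then spec_proj A x else 0)"
proof (cases "x = y")
  case True
  then show ?thesis unfolding spec_proj_def mat_fun_mult[OF A]
    by (auto intro: mat_fun_cong[OF A])
next
  case False
  have "spec_proj A x ** spec_proj A y = mat_fun (\<lambda>_. 0) A"
    unfolding spec_proj_def mat_fun_mult[OF A] using False by (intro mat_fun_cong[OF A]) auto
  then show ?thesis using False by (simp add: mat_fun_const[OF A])
qed

lemma mult_spec_proj:
  assumes A: "cadj A = A"
  shows "A ** spec_proj A x = x *\<^sub>R spec_proj A x" "spec_proj A x ** A = x *\<^sub>R spec_proj A x"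
proof -
  have "mat_fun (\<lambda>y. y) A ** spec_proj A x = x *\<^sub>R spec_proj A x"
    "spec_proj A x ** mat_fun (\<lambda>y. y) A = x *\<^sub>R spec_proj A x"
    unfolding spec_proj_def mat_fun_mult[OF A] mat_fun_scaleR[OF A]
    by (auto intro: mat_fun_cong[OF A])
  then show "A ** spec_proj A x = x *\<^sub>R spec_proj A x" "spec_proj A x ** A = x *\<^sub>R spec_proj A x"
    by (simp_all add: mat_fun_ident[OF A])
qed

lemma sum_spec_proj:
  assumes "cadj A = A"
  shows "(\<Sum>x\<in>eigvals A. spec_proj A x) = mat 1"
  using mat_fun_eq_sum[OF assms, of "\<lambda>_. 1"] mat_fun_const[OF assms, of 1] by simp

section \<open>Matrix functions within the algebra, positivity of the spectrum\<close>

lemma subspace_cstar_subalgebra: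
  assumes "unital_cstar_subalgebra \<A>"
  shows "subspace \<A>"
proof (rule subspaceI)
  have scal: "c *\<^sub>R B \<in> \<A>" if "B \<in> \<A>" for c B
    using assms that by (metis mat_mult_eq_scaleR unital_cstar_subalgebra_def)
  then show "c *\<^sub>R B \<in> \<A>" if "B \<in> \<A>" for c B using that .
  show "0 \<in> \<A>" using scal[of "mat 1" 0] assms by (simp add: unital_cstar_subalgebra_def)
qed (use assms in \<open>auto simp: unital_cstar_subalgebra_def\<close>)

text \<open>Membership uses Lagrange interpolation on the spectrum.\<close>

lemma mat_fun_in_subalgebra:
  fixes A :: "'n::finite cmat"
  assumes alg: "unital_cstar_subalgebra \<A>" and mem: "A \<in> \<A>" and A: "cadj A = A"
  shows "mat_fun f A \<in> \<A>"
proof -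
  have scal: "c *\<^sub>R B \<in> \<A>" if "B \<in> \<A>" for c B
    using subspace_scale[OF subspace_cstar_subalgebra[OF alg]] that .
  have one: "c *\<^sub>R mat 1 \<in> \<A>" for c
    using alg scal by (auto simp: unital_cstar_subalgebra_def)
  note fin = finite_eigvals[OF A]
  have poly: "mat_fun (\<lambda>y. \<Prod>z\<in>I. (y - z)) A \<in> \<A>" if "finite I" for I
    using that
  proof (induction I rule: finite_induct)
    case empty
    then show ?case using one[of 1] by (simp add: mat_fun_const[OF A])
  next
    case (insert z I)
    have "mat_fun (\<lambda>y. y - z) A = A + (- z) *\<^sub>R mat 1"
      using mat_fun_add[OF A, of "\<lambda>x. x" "\<lambda>x. - z"]
      by (simp add: mat_fun_const[OF A] mat_fun_ident[OF A])
    then have "mat_fun (\<lambda>y. y - z) A \<in> \<A>"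
      using alg mem one[of "- z"] unfolding unital_cstar_subalgebra_def by metis
    then have "mat_fun (\<lambda>y. y - z) A ** mat_fun (\<lambda>y. \<Prod>z\<in>I. (y - z)) A \<in> \<A>"
      using alg insert.IH by (simp add: unital_cstar_subalgebra_def)
    then show ?case using insert by (simp add: mat_fun_mult[OF A])
  qed
  have proj: "spec_proj A x \<in> \<A>" if x: "x \<in> eigvals A" for x
  proof -
    let ?I = "eigvals A - {x}"
    let ?c = "\<Prod>z\<in>?I. (x - z)"
    have c: "?c \<noteq> 0" using fin by simp
    have "spec_proj A x = mat_fun (\<lambda>y. inverse ?c * (\<Prod>z\<in>?I. (y - z))) A"
      unfolding spec_proj_def
    proof (rule mat_fun_cong[OF A])
      fix y assume y: "y \<in> eigvals A"
      show "(if y = x then 1 else 0) = inverse ?c * (\<Prod>z\<in>?I. (y - z))"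
      proof (cases "y = x")
        case True
        then show ?thesis using c by simp
      next
        case False
        then have "(\<Prod>z\<in>?I. (y - z)) = 0" using y fin by (intro prod_zero) auto
        then show ?thesis using False by simp
      qed
    qed
    also have "\<dots> = inverse ?c *\<^sub>R mat_fun (\<lambda>y. \<Prod>z\<in>?I. (y - z)) A"
      by (simp only: mat_fun_scaleR[OF A])
    finally show ?thesis using scal poly[of ?I] fin by simp
  qed
  show ?thesis
    unfolding mat_fun_eq_sum[OF A]
    by (intro subspace_sum subspace_cstar_subalgebra[OF alg] scal proj)
qed

lemma scaleR_matrix_vector_mult: "(r *\<^sub>R A) *v v = r *\<^sub>R (A *v v)" for A :: "'n::finite cmat"
  by (simp add: vec_eq_iff matrix_vector_mult_def scaleR_sum_right)

lemma pos_def_eigvals: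
  assumes "pos_def A" and x: "x \<in> eigvals A"
  shows "x > 0"
proof -
  have A: "cadj A = A" using assms by (simp add: pos_def_def)
  have "spec_proj A x \<noteq> 0" using x by (simp add: eigvals_def)
  then obtain w where w: "spec_proj A x *v w \<noteq> 0"
    by (metis matrix_eq matrix_vector_mult_0)
  define v where "v = spec_proj A x *v w"
  have "A *v v = x *\<^sub>R v"
    unfolding v_def by (simp add: matrix_vector_mul_assoc mult_spec_proj[OF A] scaleR_matrix_vector_mult)
  then have "Re (sesq v A v) = x * (norm v)\<^sup>2"
    by (simp add: sesq_eq_hdot hdot_scaleR_right hdot_self)
  moreover have "Re (sesq v A v) > 0"
    using assms(1) w by (simp add: pos_def_def v_def)
  ultimately show ?thesis by (simp add: zero_less_mult_iff)
qed

subsection \<open>Relative entropy\<close>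

text \<open>The trace is the squared Hilbert-Schmidt norm of the product of the two projections.
  These numbers are the weights with which scalar inequalities are summed over pairs of eigenvalues
  of two noncommuting matrices.\<close>

lemma trace_spec_proj_mult_nonneg:
  assumes A: "cadj A = A" and B: "cadj B = B"
  shows "Re (trace (spec_proj A x ** spec_proj B y)) \<ge> 0"
proof -
  let ?E = "spec_proj A x" and ?F = "spec_proj B y"
  have "trace (?E ** ?F) = trace (?E ** (?F ** ?F))"
    by (simp add: spec_proj_mult[OF B])
  also have "\<dots> = trace ((?E ** ?F) ** ?F)" by (simp only: matrix_mul_assoc)
  also have "\<dots> = trace (?F ** ((?E ** ?E) ** ?F))"
    unfolding trace_mul_sym[of "?E ** ?F"] by (simp add: spec_proj_mult[OF A])
  also have "\<dots> = trace (cadj (?E ** ?F) ** (?E ** ?F))"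
    by (simp add: cadj_mult cadj_spec_proj A B matrix_mul_assoc)
  finally show ?thesis by (simp flip: inner_eq_trace)
qed

lemma trace_mat_fun_mult:
  assumes A: "cadj A = A" and B: "cadj B = B"
  shows "Re (trace (mat_fun f A ** mat_fun g B)) =
    (\<Sum>x\<in>eigvals A. \<Sum>y\<in>eigvals B. f x * g y * Re (trace (spec_proj A x ** spec_proj B y)))"
  unfolding mat_fun_eq_sum[OF A, of f] mat_fun_eq_sum[OF B, of g]
  by (simp add: mm.sum_left mm.sum_right mm.scaleR_left mm.scaleR_right trace_sum trace_scaleR
      sum_distrib_left mult.assoc) (subst sum.swap, simp add: mult.left_commute)

lemma pos_def_mult_inverse:
  assumes "pos_def B"
  shows "B ** mat_fun inverse B = mat 1"
proof -
  have hB: "cadj B = B" using assms by (simp add: pos_def_def)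
  have "B ** mat_fun inverse B = mat_fun (\<lambda>y. y * inverse y) B"
    using mat_fun_mult[OF hB, of "\<lambda>x. x" inverse] by (simp add: mat_fun_ident[OF hB])
  also have "\<dots> = mat_fun (\<lambda>_. 1) B"
    using pos_def_eigvals[OF assms] by (intro mat_fun_cong[OF hB]) force
  finally show ?thesis using mat_fun_const[OF hB, of 1] by simp
qed

text \<open>Both bounds come from \<open>ln u \<le> u - 1\<close>; the upper one is the \<open>\<chi>\<^sup>2\<close>-divergence, which is
  quadratic in \<open>A - B\<close>.\<close>

lemma rel_entropy_bounds:
  fixes A B :: "'n::finite cmat"
  assumes A: "pos_def A" "trace A = 1" and B: "pos_def B" "trace B = 1"
  shows "0 \<le> rel_entropy A B"
    and "rel_entropy A B \<le> Re (trace ((A - B) ** (A - B) ** mat_fun inverse B))"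
proof -
  have hA: "cadj A = A" and hB: "cadj B = B" using A B by (simp_all add: pos_def_def)
  let ?p = "\<lambda>x y. Re (trace (spec_proj A x ** spec_proj B y))"
  note p = trace_spec_proj_mult_nonneg[OF hA hB]
  note T = trace_mat_fun_mult[OF hA hB]
  have c1: "mat_fun (\<lambda>_. 1) C = mat 1" if "cadj C = C" for C :: "'n cmat"
    using mat_fun_const[OF that, of 1] by simp
  have AlnA: "A ** mat_ln A = mat_fun (\<lambda>x. x * ln x) A"
    using mat_fun_mult[OF hA, of "\<lambda>x. x" ln] by (simp add: mat_fun_ident[OF hA] mat_ln_def)
  have "rel_entropy A B = Re (trace (mat_fun (\<lambda>x. x * ln x) A ** mat_fun (\<lambda>_. 1) B))
      - Re (trace (mat_fun (\<lambda>x. x) A ** mat_fun ln B))"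
    unfolding rel_entropy_def mm.diff_right trace_sub AlnA
    by (simp add: mat_fun_ident[OF hA] mat_ln_def c1[OF hB])
  then have D: "rel_entropy A B = (\<Sum>x\<in>eigvals A. \<Sum>y\<in>eigvals B. (x * ln x - x * ln y) * ?p x y)"
    unfolding T by (simp add: sum_subtractf algebra_simps)
  \<comment> \<open>Both traces being 1, the terms linear in \<open>x\<close> and in
    \<open>y\<close> have the same weighted sum. This cancels the lower bound and gives the constant
    in the upper one.\<close>
  have trA: "1 = (\<Sum>x\<in>eigvals A. \<Sum>y\<in>eigvals B. x * ?p x y)"
    using T[of "\<lambda>x. x" "\<lambda>_. 1"] A by (simp add: mat_fun_ident[OF hA] c1[OF hB])
  have trB: "1 = (\<Sum>x\<in>eigvals A. \<Sum>y\<in>eigvals B. y * ?p x y)"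
    using T[of "\<lambda>_. 1" "\<lambda>x. x"] B by (simp add: mat_fun_ident[OF hB] c1[OF hA])
  have le: "u * (ln u - ln v) \<ge> u - v" "u * (ln u - ln v) \<le> u * u * inverse v - u"
    if "u > 0" "v > 0" for u v :: real
  proof -
    have "u * ln (v / u) \<le> u * (v / u - 1)"
      using that by (intro mult_left_mono ln_le_minus_one) auto
    then show "u * (ln u - ln v) \<ge> u - v"
      using that by (simp add: ln_div algebra_simps)
    have "u * ln (u / v) \<le> u * (u / v - 1)"
      using that by (intro mult_left_mono ln_le_minus_one) auto
    moreover have "ln (u / v) = ln u - ln v" using that by (simp add: ln_div)
    moreover have "u * (u / v - 1) = u * u * inverse v - u"
      by (simp add: divide_inverse algebra_simps)
    ultimately show "u * (ln u - ln v) \<le> u * u * inverse v - u" by simp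
  qed
  note pos = pos_def_eigvals[OF A(1)] pos_def_eigvals[OF B(1)]
  have "(\<Sum>x\<in>eigvals A. \<Sum>y\<in>eigvals B. (x - y) * ?p x y) \<le> rel_entropy A B"
    unfolding D using le(1)[OF pos] p
    by (intro sum_mono mult_right_mono) (auto simp: algebra_simps)
  moreover have "(\<Sum>x\<in>eigvals A. \<Sum>y\<in>eigvals B. (x - y) * ?p x y) = 0"
    using trA trB by (simp add: sum_subtractf algebra_simps)
  ultimately show "0 \<le> rel_entropy A B" by simp
  let ?R = "mat_fun inverse B"
  have "rel_entropy A B \<le> (\<Sum>x\<in>eigvals A. \<Sum>y\<in>eigvals B. (x * x * inverse y - x) * ?p x y)"
    unfolding D using le(2)[OF pos] p
    by (intro sum_mono mult_right_mono) (auto simp: algebra_simps)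
  also have "\<dots> = Re (trace (mat_fun (\<lambda>x. x * x) A ** ?R)) - 1"
    unfolding T using trA by (simp add: sum_subtractf algebra_simps)
  also have "mat_fun (\<lambda>x. x * x) A = A ** A"
    using mat_fun_mult[OF hA, of "\<lambda>x. x" "\<lambda>x. x"] by (simp add: mat_fun_ident[OF hA])
  finally have 1: "rel_entropy A B \<le> Re (trace (A ** A ** ?R)) - 1" .
  have BR: "B ** ?R = mat 1" by (rule pos_def_mult_inverse[OF B(1)])
  then have RB: "?R ** B = mat 1" using matrix_left_right_inverse by blast
  have t: "trace (B ** A ** ?R) = trace A"
  proof -
    have "trace (B ** A ** ?R) = trace ((?R ** B) ** A)"
      unfolding trace_mul_sym[of "B ** A"] by (simp only: matrix_mul_assoc)
    then show ?thesis by (simp add: RB)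
  qed
  \<comment> \<open>The three terms after \<open>A ** A ** ?R\<close> reduce to traces of
    \<open>A\<close>, \<open>A\<close> and \<open>B\<close>, contributing
    \<open>- 1 - 1 + 1\<close>.\<close>
  have "(A - B) ** (A - B) ** ?R
      = A ** A ** ?R - A ** (B ** ?R) - (B ** A ** ?R - B ** (B ** ?R))"
    by (simp add: mm.diff_left mm.diff_right matrix_mul_assoc)
  then have "trace ((A - B) ** (A - B) ** ?R) = trace (A ** A ** ?R) - 1"
    by (simp add: BR trace_sub t A B)
  then show "rel_entropy A B \<le> Re (trace ((A - B) ** (A - B) ** ?R))"
    using 1 by simp
qed

lemma rel_entropy_has_derivative:
  fixes \<gamma> :: "real \<Rightarrow> 'n::finite cmat"
  assumes der: "(\<gamma> has_vector_derivative X) (at 0)"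
    and \<epsilon>: "\<epsilon> > 0" "\<And>t. \<bar>t\<bar> < \<epsilon> \<Longrightarrow> pos_def (\<gamma> t) \<and> trace (\<gamma> t) = 1"
  shows "((\<lambda>t. rel_entropy (\<gamma> t) \<sigma>) has_real_derivative
    Re (trace (X ** (mat_ln (\<gamma> 0) - mat_ln \<sigma>)))) (at 0)"
proof -
  define \<rho> where "\<rho> = \<gamma> 0"
  define K where "K = mat_ln \<rho> - mat_ln \<sigma>"
  define R where "R = mat_fun inverse \<rho>"
  define f where "f = (\<lambda>t. rel_entropy (\<gamma> t) \<rho>)"
  define g where "g = (\<lambda>t. Re (trace ((\<gamma> t - \<rho>) ** (\<gamma> t - \<rho>) ** R)))"
  have lin: "bounded_linear (\<lambda>M. Re (trace (M ** C)))" for C :: "'n cmat"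
    by (intro bounded_linear_compose[OF bounded_linear_Re]
        bounded_linear_compose[OF bounded_linear_trace] mm.bounded_linear_left)
  have split: "rel_entropy (\<gamma> t) \<sigma> = f t + Re (trace (\<gamma> t ** K))" for t
    by (simp add: rel_entropy_def f_def K_def mm.diff_right trace_sub)
  have bound: "0 \<le> f t \<and> f t \<le> g t" if "\<bar>t\<bar> < \<epsilon>" for t
    using rel_entropy_bounds[of "\<gamma> t" \<rho>] \<epsilon>(2)[OF that] \<epsilon>(2)[of 0] \<epsilon>(1)
    by (auto simp: f_def g_def R_def \<rho>_def)
  have "((\<lambda>t. \<gamma> t - \<rho>) has_vector_derivative X) (at 0)"
    using der by (auto intro!: derivative_eq_intros)
  from mm.has_vector_derivative[OF this this]
  \<comment> \<open>Product rule at a point where both factors vanish.\<close>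
  have "((\<lambda>t. (\<gamma> t - \<rho>) ** (\<gamma> t - \<rho>)) has_vector_derivative 0) (at 0)"
    by (simp add: \<rho>_def mm.zero_left mm.zero_right)
  from bounded_linear.has_vector_derivative[OF lin[of R] this]
  have "(g has_real_derivative 0) (at 0)"
    by (simp add: g_def has_real_derivative_iff_has_vector_derivative mm.zero_left
        flip: trace_0) (simp add: trace_def)
  then have g: "((\<lambda>h. g h / h) \<longlongrightarrow> 0) (at 0)"
    by (simp add: DERIV_def g_def \<rho>_def mm.zero_left) (simp add: trace_def)
  have f0: "f 0 = 0" by (simp add: f_def rel_entropy_def \<rho>_def mm.zero_right) (simp add: trace_def)
  \<comment> \<open>Near 0 the function \<open>f\<close> lies between 0 and \<open>g\<close>, so its
    difference quotients are dominated by those of \<open>g\<close>.\<close>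
  have "((\<lambda>h. f h / h) \<longlongrightarrow> 0) (at 0)"
  proof (rule Lim_null_comparison[OF _ tendsto_norm_zero[OF g]])
    have "\<forall>\<^sub>F h in at 0. \<bar>h\<bar> < \<epsilon>"
      using \<epsilon>(1) unfolding eventually_at by (auto simp: dist_real_def)
    then show "\<forall>\<^sub>F h in at 0. norm (f h / h) \<le> norm (g h / h)"
    proof eventually_elim
      case (elim h)
      then have "\<bar>f h\<bar> \<le> \<bar>g h\<bar>" using bound[of h] by linarith
      then show ?case by (simp add: abs_divide divide_right_mono)
    qed
  qed
  then have "(f has_real_derivative 0) (at 0)" by (simp add: DERIV_def f0)
  moreover have "((\<lambda>t. Re (trace (\<gamma> t ** K))) has_real_derivative Re (trace (X ** K))) (at 0)"
    using bounded_linear.has_vector_derivative[OF lin[of K] der]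
    by (simp add: has_real_derivative_iff_has_vector_derivative)
  ultimately have "((\<lambda>t. f t + Re (trace (\<gamma> t ** K))) has_real_derivative
      0 + Re (trace (X ** K))) (at 0)"
    by (rule DERIV_add)
  then show ?thesis by (simp add: split K_def \<rho>_def)
qed

subsection \<open>The weighted multiplication operator\<close>

text \<open>The logarithmic mean with its continuous extension to equal arguments. For positive
  arguments it is the integral of \<open>a powr s * b powr (1 - s)\<close> over
  \<open>{0..1}\<close>.\<close>

definition log_mean :: "real \<Rightarrow> real \<Rightarrow> real" where
  "log_mean a b = (if a = b then a else (a - b) / (ln a - ln b))"

lemma log_mean_commute: "log_mean a b = log_mean b a"
  unfolding log_mean_def using minus_divide_divide[of "a - b" "ln a - ln b"] by auto

lemma log_mean_pos:
  assumes "a > 0" "b > 0"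
  shows "log_mean a b > 0"
proof (cases a b rule: linorder_cases)
  case less
  then show ?thesis using assms by (simp add: log_mean_def divide_neg_neg)
next
  case greater
  then show ?thesis using assms by (simp add: log_mean_def)
qed (use assms in \<open>simp add: log_mean_def\<close>)

lemma log_mean_mult_ln_diff:
  assumes "a > 0" "b > 0"
  shows "log_mean a b * (ln a - ln b) = a - b"
  using assms by (simp add: log_mean_def)

lemma has_integral_log_mean:
  assumes "a > 0" "b > 0"
  shows "((\<lambda>s. a powr s * b powr (1 - s)) has_integral log_mean a b) {0..1}"
proof (cases "a = b")
  case True
  then have "a powr s * b powr (1 - s) = a" for s
    using assms by (simp flip: powr_add)
  then show ?thesis using True has_integral_const_real[of a 0 1] by (simp add: log_mean_def)
next
  case False
  define c where "c = ln a - ln b"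
  have c: "c \<noteq> 0" using False assms by (simp add: c_def)
  have "((\<lambda>s. a powr s * b powr (1 - s)) has_integral
      (a powr 1 * b powr (1 - 1) / c - a powr 0 * b powr (1 - 0) / c)) {0..1}"
  proof (rule fundamental_theorem_of_calculus)
    fix s :: real
    have "((\<lambda>s. a powr s * b powr (1 - s) / c) has_real_derivative
        (a powr s * ln a * b powr (1 - s) - a powr s * (b powr (1 - s) * ln b)) / c)
        (at s within {0..1})"
      using assms c unfolding powr_def
      by (auto intro!: derivative_eq_intros simp: field_simps)
    moreover have "(a powr s * ln a * b powr (1 - s) - a powr s * (b powr (1 - s) * ln b)) / c
        = a powr s * b powr (1 - s)"
      using c by (simp add: field_simps) (simp add: c_def algebra_simps)
    ultimately show "((\<lambda>s. a powr s * b powr (1 - s) / c) has_vector_derivative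
        a powr s * b powr (1 - s)) (at s within {0..1})"
      by (simp add: has_real_derivative_iff_has_vector_derivative)
  qed simp
  then show ?thesis using False assms by (simp add: log_mean_def c_def diff_divide_distrib)
qed

text \<open>The factor by which \<open>weight_op \<rho> w\<close> multiplies the block between the
  eigenspaces of \<open>x\<close> and \<open>y\<close>: the exponential weight splits as
  \<open>exp (w / 2) powr s * exp (- w / 2) powr (1 - s)\<close> and is absorbed into the two
  eigenvalues.\<close>

definition weight_coeff :: "real \<Rightarrow> real \<Rightarrow> real \<Rightarrow> real" where
  "weight_coeff w x y = log_mean (exp (w / 2) * x) (exp (- w / 2) * y)"

lemma weight_coeff_swap: "weight_coeff w x y = weight_coeff (- w) y x"
  unfolding weight_coeff_def by (simp add: log_mean_commute)

lemma weight_coeff_pos: "x > 0 \<Longrightarrow> y > 0 \<Longrightarrow> weight_coeff w x y > 0"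
  unfolding weight_coeff_def by (simp add: log_mean_pos)

text \<open>The second factor is the difference of the logarithms of
  \<open>exp (- w / 2) * y\<close> and \<open>exp (w / 2) * x\<close>, hence cancels the denominator
  of the logarithmic mean. This is the scalar form of
  \<open>weight_op_commutator_log\<close>.\<close>

lemma weight_coeff_mult:
  assumes "x > 0" "y > 0"
  shows "weight_coeff w x y * (ln y - ln x - w) = exp (- w / 2) * y - exp (w / 2) * x"
  using log_mean_mult_ln_diff[of "exp (w / 2) * x" "exp (- w / 2) * y"] assms
  by (simp add: weight_coeff_def ln_mult algebra_simps)

lemma mat_powr_eq_sum:
  "cadj \<rho> = \<rho> \<Longrightarrow> mat_powr \<rho> s = (\<Sum>x\<in>eigvals \<rho>. (x powr s) *\<^sub>R spec_proj \<rho> x)"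
  by (simp add: mat_powr_def mat_fun_eq_sum)

text \<open>With the spectral resolution inserted on both sides, the integrand becomes a finite sum
  of scalar functions times fixed blocks.\<close>

lemma has_integral_weight_op_sum:
  assumes \<rho>: "pos_def \<rho>"
  shows "((\<lambda>s. exp (w * (s - 1/2)) *\<^sub>R (mat_powr \<rho> s ** A ** mat_powr \<rho> (1 - s)))
    has_integral (\<Sum>x\<in>eigvals \<rho>. \<Sum>y\<in>eigvals \<rho>.
      weight_coeff w x y *\<^sub>R (spec_proj \<rho> x ** A ** spec_proj \<rho> y))) {0..1}"
proof -
  have h: "cadj \<rho> = \<rho>" using \<rho> by (simp add: pos_def_def)
  let ?E = "spec_proj \<rho>" and ?S = "eigvals \<rho>"
  have eq: "exp (w * (s - 1/2)) *\<^sub>R (mat_powr \<rho> s ** A ** mat_powr \<rho> (1 - s)) =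
    (\<Sum>x\<in>?S. \<Sum>y\<in>?S. ((exp (w / 2) * x) powr s * (exp (- w / 2) * y) powr (1 - s))
       *\<^sub>R (?E x ** A ** ?E y))" for s
  proof -
    have e: "exp (w * (s - 1/2)) = exp (w / 2) powr s * exp (- w / 2) powr (1 - s)"
      by (simp add: powr_def flip: exp_add) (simp add: field_simps)
    have p: "(exp (w / 2) * x) powr s * (exp (- w / 2) * y) powr (1 - s)
        = exp (w * (s - 1/2)) * (x powr s * y powr (1 - s))" if "x \<in> ?S" "y \<in> ?S" for x y
      using pos_def_eigvals[OF \<rho>] that unfolding e
      by (subst (1 2) powr_mult) (auto simp: less_imp_le)
    have "exp (w * (s - 1/2)) *\<^sub>R (mat_powr \<rho> s ** A ** mat_powr \<rho> (1 - s)) =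
      (\<Sum>x\<in>?S. \<Sum>y\<in>?S. (exp (w * (s - 1/2)) * (x powr s * y powr (1 - s)))
         *\<^sub>R (?E x ** A ** ?E y))"
      unfolding mat_powr_eq_sum[OF h] mm.sum_left mm.scaleR_left unfolding mm.sum_right
        mm.scaleR_right scaleR_sum_right scaleR_scaleR
      by (simp only: mult_ac)
    also have "\<dots> = (\<Sum>x\<in>?S. \<Sum>y\<in>?S.
        ((exp (w / 2) * x) powr s * (exp (- w / 2) * y) powr (1 - s)) *\<^sub>R (?E x ** A ** ?E y))"
      by (intro sum.cong refl) (simp only: p)
    finally show ?thesis .
  qed
  show ?thesis
    unfolding eq weight_coeff_def
    by (intro has_integral_sum finite_eigvals h has_integral_scaleR_left has_integral_log_mean)
       (simp_all add: pos_def_eigvals[OF \<rho>])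
qed

text \<open>The integral form is kept next to the finite sum because \<open>flux_mem\<close> argues
  at each fixed \<open>s\<close>.\<close>

lemma has_integral_weight_op:
  assumes "pos_def \<rho>"
  shows "((\<lambda>s. exp (w * (s - 1/2)) *\<^sub>R (mat_powr \<rho> s ** A ** mat_powr \<rho> (1 - s)))
    has_integral weight_op \<rho> w A) {0..1}"
  unfolding weight_op_def
  by (rule integrable_integral) (rule has_integral_integrable[OF has_integral_weight_op_sum[OF assms]])

lemma weight_op_eq_sum:
  assumes "pos_def \<rho>"
  shows "weight_op \<rho> w A = (\<Sum>x\<in>eigvals \<rho>. \<Sum>y\<in>eigvals \<rho>.
      weight_coeff w x y *\<^sub>R (spec_proj \<rho> x ** A ** spec_proj \<rho> y))"
  unfolding weight_op_def by (rule integral_unique[OF has_integral_weight_op_sum[OF assms]])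

lemma linear_weight_op: "pos_def \<rho> \<Longrightarrow> linear (weight_op \<rho> w)"
  by (rule linearI) (simp_all add: weight_op_eq_sum mm.add_left mm.add_right mm.scaleR_left
      mm.scaleR_right scaleR_add_right sum.distrib scaleR_sum_right mult.commute)

text \<open>Taking adjoints exchanges \<open>x\<close> and \<open>y\<close>; since the logarithmic
  mean is symmetric, this amounts to a change of sign of \<open>w\<close>.\<close>

lemma cadj_weight_op:
  assumes \<rho>: "pos_def \<rho>"
  shows "cadj (weight_op \<rho> w A) = weight_op \<rho> (- w) (cadj A)"
proof -
  have h: "cadj \<rho> = \<rho>" using \<rho> by (simp add: pos_def_def)
  show ?thesis
    unfolding weight_op_eq_sum[OF \<rho>] cadj_sum cadj_scaleR cadj_mult cadj_spec_proj[OF h]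
    by (subst sum.swap) (simp add: matrix_mul_assoc weight_coeff_swap[of w])
qed

lemma inner_spec_proj_sandwich:
  assumes h: "cadj \<rho> = \<rho>"
  shows "inner A (spec_proj \<rho> x ** A ** spec_proj \<rho> y) = (norm (spec_proj \<rho> x ** A ** spec_proj \<rho> y))\<^sup>2"
proof -
  let ?E = "spec_proj \<rho> x" and ?F = "spec_proj \<rho> y"
  have "trace (cadj (?E ** A ** ?F) ** (?E ** A ** ?F))
      = trace (?F ** (cadj A ** ((?E ** ?E) ** A ** ?F)))"
    by (simp add: cadj_mult cadj_spec_proj[OF h] matrix_mul_assoc)
  also have "\<dots> = trace (cadj A ** ((?E ** ?E) ** A ** (?F ** ?F)))"
    unfolding trace_mul_sym[of ?F] by (simp only: matrix_mul_assoc)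
  also have "\<dots> = trace (cadj A ** (?E ** A ** ?F))"
    by (simp add: spec_proj_mult[OF h])
  finally show ?thesis unfolding power2_norm_eq_inner by (simp add: inner_eq_trace)
qed

text \<open>The quadratic form is a sum of squared block norms with positive coefficients, and the
  blocks add up to \<open>A\<close>.\<close>

lemma inner_weight_op:
  assumes \<rho>: "pos_def \<rho>"
  shows "inner A (weight_op \<rho> w A) \<ge> 0"
    and "inner A (weight_op \<rho> w A) = 0 \<Longrightarrow> A = 0"
proof -
  have h: "cadj \<rho> = \<rho>" using \<rho> by (simp add: pos_def_def)
  let ?E = "spec_proj \<rho>" and ?S = "eigvals \<rho>"
  have eq: "inner A (weight_op \<rho> w A) =
      (\<Sum>x\<in>?S. \<Sum>y\<in>?S. weight_coeff w x y * (norm (?E x ** A ** ?E y))\<^sup>2)"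
    by (simp add: weight_op_eq_sum[OF \<rho>] inner_sum_right inner_spec_proj_sandwich[OF h])
  have nonneg: "weight_coeff w x y * (norm (?E x ** A ** ?E y))\<^sup>2 \<ge> 0" if "x \<in> ?S" "y \<in> ?S" for x y
    using weight_coeff_pos[of x y w] pos_def_eigvals[OF \<rho>] that by (simp add: less_imp_le)
  then show "inner A (weight_op \<rho> w A) \<ge> 0"
    unfolding eq by (intro sum_nonneg)
  note fin = finite_eigvals[OF h]
  assume "inner A (weight_op \<rho> w A) = 0"
  then have row: "\<forall>x\<in>?S. (\<Sum>y\<in>?S. weight_coeff w x y * (norm (?E x ** A ** ?E y))\<^sup>2) = 0"
    unfolding eq by (subst (asm) sum_nonneg_eq_0_iff) (auto intro!: sum_nonneg nonneg fin)
  have "weight_coeff w x y * (norm (?E x ** A ** ?E y))\<^sup>2 = 0" if xy: "x \<in> ?S" "y \<in> ?S" for x y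
    by (rule sum_nonneg_0[OF fin _ _ xy(2)]) (use row xy nonneg in auto)
  then have z: "?E x ** A ** ?E y = 0" if "x \<in> ?S" "y \<in> ?S" for x y
    using weight_coeff_pos[of x y w] pos_def_eigvals[OF \<rho>] that by force
  have "A = (\<Sum>x\<in>?S. ?E x) ** A ** (\<Sum>y\<in>?S. ?E y)"
    by (simp add: sum_spec_proj[OF h])
  also have "\<dots> = 0" using z by (simp add: mm.sum_left mm.sum_right)
  finally show "A = 0" .
qed

subsection \<open>Eigenvectors of the modular operator\<close>

lemmas mm_simps = mm.add_left mm.add_right mm.diff_left mm.diff_right mm.minus_left mm.minus_right
  mm.scaleR_left mm.scaleR_right mm.zero_left mm.zero_right matrix_mul_assoc

text \<open>Inserting the identity on the far side writes left multiplication over the same blocks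
  as right multiplication, so the two can be compared block by block.\<close>

lemma mat_fun_mult_left:
  assumes "cadj A = A"
  shows "mat_fun f A ** M =
    (\<Sum>x\<in>eigvals A. \<Sum>y\<in>eigvals A. f x *\<^sub>R (spec_proj A x ** M ** spec_proj A y))"
proof -
  have "mat_fun f A ** M = mat_fun f A ** M ** (\<Sum>y\<in>eigvals A. spec_proj A y)"
    by (simp add: sum_spec_proj[OF assms])
  then show ?thesis
    unfolding mat_fun_eq_sum[OF assms, of f] mm.sum_left mm.scaleR_left
    unfolding mm.sum_right scaleR_sum_right .
qed

lemma mat_fun_mult_right:
  assumes "cadj A = A"
  shows "M ** mat_fun f A =
    (\<Sum>x\<in>eigvals A. \<Sum>y\<in>eigvals A. f y *\<^sub>R (spec_proj A x ** M ** spec_proj A y))"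
proof -
  have "M ** mat_fun f A = (\<Sum>x\<in>eigvals A. spec_proj A x) ** M ** mat_fun f A"
    by (simp add: sum_spec_proj[OF assms])
  then show ?thesis
    unfolding mat_fun_eq_sum[OF assms, of f] mm.sum_left
    unfolding mm.sum_right mm.scaleR_right .
qed

text \<open>A block \<open>spec_proj A x ** V ** spec_proj A y\<close> is zero unless
  \<open>x = c * y\<close>. Hence \<open>f\<close> and \<open>g\<close> have to be compared only
  where both numbers are eigenvalues.\<close>

lemma mat_fun_intertwine:
  assumes A: "cadj A = A" and V: "A ** V = c *\<^sub>R (V ** A)"
    and fg: "\<And>y. c * y \<in> eigvals A \<Longrightarrow> y \<in> eigvals A \<Longrightarrow> f (c * y) = g y"
  shows "mat_fun f A ** V = V ** mat_fun g A"
  unfolding mat_fun_mult_left[OF A] mat_fun_mult_right[OF A]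
proof (intro sum.cong refl)
  fix x y assume xy: "x \<in> eigvals A" "y \<in> eigvals A"
  let ?M = "spec_proj A x ** V ** spec_proj A y"
  have "x *\<^sub>R ?M = spec_proj A x ** (A ** V) ** spec_proj A y"
    by (simp add: mm_simps mult_spec_proj[OF A])
  also have "\<dots> = c *\<^sub>R (spec_proj A x ** V ** (A ** spec_proj A y))"
    unfolding V by (simp add: mm_simps)
  also have "\<dots> = (c * y) *\<^sub>R ?M"
    unfolding mult_spec_proj(1)[OF A] by (simp add: mm_simps)
  finally have "?M = 0 \<or> x = c * y" by auto
  then show "f x *\<^sub>R ?M = g y *\<^sub>R ?M" using fg xy by auto
qed

lemma modular_op_eigenvector:
  assumes \<sigma>: "pos_def \<sigma>" and V: "modular_op \<sigma> V = c *\<^sub>R V"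
  shows "\<sigma> ** V = c *\<^sub>R (V ** \<sigma>)"
proof -
  have 1: "\<sigma> ** mat_fun inverse \<sigma> = mat 1" by (rule pos_def_mult_inverse[OF \<sigma>])
  then have "mat_fun inverse \<sigma> ** \<sigma> = mat 1" using matrix_left_right_inverse by blast
  \<comment> \<open>\<open>matrix_inv\<close> is defined by choice, so its inverse property needs a
    witness; the functional calculus provides one.\<close>
  with 1 have "\<sigma> ** matrix_inv \<sigma> = mat 1 \<and> matrix_inv \<sigma> ** \<sigma> = mat 1"
    unfolding matrix_inv_def
    using someI[of "\<lambda>B. \<sigma> ** B = mat 1 \<and> B ** \<sigma> = mat 1" "mat_fun inverse \<sigma>"] by blast
  then have "\<sigma> ** V = modular_op \<sigma> V ** \<sigma>"
    unfolding modular_op_def by (simp flip: matrix_mul_assoc)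
  then show ?thesis by (simp add: V mm_simps)
qed

lemma mat_powr_intertwine:
  assumes \<sigma>: "pos_def \<sigma>" and V: "\<sigma> ** V = exp w *\<^sub>R (V ** \<sigma>)"
  shows "mat_powr \<sigma> s ** V = exp (w * s) *\<^sub>R (V ** mat_powr \<sigma> s)"
proof -
  have h: "cadj \<sigma> = \<sigma>" using \<sigma> by (simp add: pos_def_def)
  have "mat_powr \<sigma> s ** V = V ** mat_fun (\<lambda>y. exp (w * s) * y powr s) \<sigma>"
    unfolding mat_powr_def
  proof (rule mat_fun_intertwine[OF h V])
    fix y assume "y \<in> eigvals \<sigma>"
    then have "y > 0" by (rule pos_def_eigvals[OF \<sigma>])
    then show "(exp w * y) powr s = exp (w * s) * y powr s"
      by (simp add: powr_def ln_mult distrib_left exp_add mult.commute)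
  qed
  also have "mat_fun (\<lambda>y. exp (w * s) * y powr s) \<sigma> = exp (w * s) *\<^sub>R mat_powr \<sigma> s"
    unfolding mat_powr_def mat_fun_scaleR[OF h] ..
  finally show ?thesis by (simp add: mm_simps)
qed

text \<open>\<open>V j\<close> satisfies the premise with \<open>w = - \<omega> j\<close>, so its
  commutator with \<open>mat_ln \<sigma>\<close> is \<open>\<omega> j *\<^sub>R V j\<close>.\<close>

lemma mat_ln_intertwine:
  assumes \<sigma>: "pos_def \<sigma>" and V: "\<sigma> ** V = exp w *\<^sub>R (V ** \<sigma>)"
  shows "commutator V (mat_ln \<sigma>) = - w *\<^sub>R V"
proof -
  have h: "cadj \<sigma> = \<sigma>" using \<sigma> by (simp add: pos_def_def)
  have "mat_ln \<sigma> ** V = V ** mat_fun (\<lambda>y. ln y + w) \<sigma>"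
    unfolding mat_ln_def
  proof (rule mat_fun_intertwine[OF h V])
    fix y assume "y \<in> eigvals \<sigma>"
    then have "y > 0" by (rule pos_def_eigvals[OF \<sigma>])
    then show "ln (exp w * y) = ln y + w" by (simp add: ln_mult)
  qed
  also have "mat_fun (\<lambda>y. ln y + w) \<sigma> = mat_ln \<sigma> + w *\<^sub>R mat 1"
    unfolding mat_ln_def mat_fun_add[OF h, symmetric] mat_fun_const[OF h] ..
  finally show ?thesis by (simp add: commutator_def mm_simps)
qed

lemma mat_powr_minus_inverse:
  assumes \<sigma>: "pos_def \<sigma>"
  shows "mat_powr \<sigma> s ** mat_powr \<sigma> (- s) = mat 1"
proof -
  have h: "cadj \<sigma> = \<sigma>" using \<sigma> by (simp add: pos_def_def)
  have "mat_powr \<sigma> s ** mat_powr \<sigma> (- s) = mat_fun (\<lambda>_. 1) \<sigma>"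
    unfolding mat_powr_def mat_fun_mult[OF h]
    using pos_def_eigvals[OF \<sigma>] by (intro mat_fun_cong[OF h]) (force simp flip: powr_add)
  then show ?thesis by (simp add: mat_fun_const[OF h])
qed

section \<open>Integration in subspaces and commutator identities\<close>

text \<open>Pairing with the component \<open>z\<close> of the integral orthogonal to
  \<open>S\<close> integrates the zero function, so \<open>z\<close> vanishes.\<close>

lemma has_integral_in_subspace:
  fixes f :: "real \<Rightarrow> 'a::euclidean_space"
  assumes S: "subspace S" and f: "(f has_integral I) X" and mem: "\<And>x. f x \<in> S"
  shows "I \<in> S"
proof -
  obtain y z where y: "y \<in> span S" and z: "\<And>w. w \<in> span S \<Longrightarrow> orthogonal z w" and I: "I = y + z"
    using orthogonal_subspace_decomp_exists[of S I] by blast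
  have "((\<lambda>x. inner (f x) z) has_integral inner I z) X"
    using has_integral_linear[OF f bounded_linear_inner_left[of z]] by (simp add: o_def)
  moreover have "inner (f x) z = 0" for x
    using z[OF span_base[OF mem]] by (simp add: orthogonal_def inner_commute)
  ultimately have "inner I z = 0" using has_integral_unique[of "\<lambda>_. 0"] by fastforce
  moreover have "inner y z = 0" using z[OF y] by (simp add: orthogonal_def inner_commute)
  ultimately have "z = 0" by (simp add: I inner_add_left)
  then show ?thesis using y S I by (metis add.right_neutral span_eq_iff)
qed

lemma linear_commutator_left: "linear (\<lambda>A. commutator A B)"
  by (rule linearI) (simp_all add: commutator_def mm_simps algebra_simps)

lemma linear_commutator_right: "linear (commutator A)"
  by (rule linearI) (simp_all add: commutator_def mm_simps algebra_simps)

lemma cadj_commutator: "cadj (commutator A B) = commutator (cadj B) (cadj A)"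
  by (simp add: commutator_def cadj_diff cadj_mult)

lemma trace_commutator: "trace (commutator A B) = 0"
  by (simp add: commutator_def trace_sub trace_mul_sym[of A B])

text \<open>Integration by parts: the commutator with \<open>cadj V\<close> is, up to sign, the
  adjoint of the derivation given by \<open>V\<close>.\<close>

lemma inner_commutator: "inner U (commutator W (cadj V)) = - inner (commutator V U) W"
proof -
  have "trace (cadj U ** W ** cadj V) = trace (cadj V ** (cadj U ** W))"
    by (rule trace_mul_sym)
  then show ?thesis
    by (simp add: inner_eq_trace commutator_def cadj_diff cadj_mult mm_simps trace_sub)
qed

subsection \<open>Generators in standard form\<close>

text \<open>The \<open>V j\<close> may lie outside \<open>\<A>\<close>; \<open>L_mem\<close> is what
  ties sums over them to the algebra.\<close>

locale standard_generator =
  fixes \<A> :: "'n::finite cmat set" and \<sigma> :: "'n cmat" and L :: "'n cmat \<Rightarrow> 'n cmat"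
    and J :: "'j set" and V :: "'j \<Rightarrow> 'n cmat" and \<omega> :: "'j \<Rightarrow> real"
  assumes alg: "unital_cstar_subalgebra \<A>"
    and \<sigma>_mem: "\<sigma> \<in> \<A>" and \<sigma>_pos: "pos_def \<sigma>"
    and form: "standard_form \<A> \<sigma> L J V \<omega>"
    and L_mem: "\<And>A. A \<in> \<A> \<Longrightarrow> L A \<in> \<A>"
begin

lemma sub: "subspace \<A>"
  by (rule subspace_cstar_subalgebra[OF alg])

lemmas add_mem = subspace_add[OF sub] and diff_mem = subspace_diff[OF sub]
  and scaleR_mem = subspace_scale[OF sub] and zero_mem = subspace_0[OF sub]
  and minus_mem = subspace_neg[OF sub]

lemma mult_mem: "A \<in> \<A> \<Longrightarrow> B \<in> \<A> \<Longrightarrow> A ** B \<in> \<A>"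
  and one_mem: "mat 1 \<in> \<A>"
  using alg by (simp_all add: unital_cstar_subalgebra_def)

lemma mat_powr_mem: "A \<in> \<A> \<Longrightarrow> pos_def A \<Longrightarrow> mat_powr A s \<in> \<A>"
  unfolding mat_powr_def using alg by (simp add: mat_fun_in_subalgebra pos_def_def)

lemmas mems = add_mem diff_mem scaleR_mem mult_mem one_mem minus_mem

lemma log_diff_mem:
  assumes "\<rho> \<in> \<A>" "pos_def \<rho>"
  shows "mat_ln \<rho> - mat_ln \<sigma> \<in> \<A>" "cadj (mat_ln \<rho> - mat_ln \<sigma>) = mat_ln \<rho> - mat_ln \<sigma>"
  using assms \<sigma>_mem \<sigma>_pos
  by (auto simp: mat_ln_def pos_def_def cadj_diff cadj_mat_fun
      intro!: mems mat_fun_in_subalgebra[OF alg])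

lemma finite_J: "finite J"
  using form by (simp add: standard_form_def)

lemma V_intertwine:
  assumes "j \<in> J"
  shows "\<sigma> ** V j = exp (- \<omega> j) *\<^sub>R (V j ** \<sigma>)"
    and "\<sigma> ** cadj (V j) = exp (\<omega> j) *\<^sub>R (cadj (V j) ** \<sigma>)"
proof -
  have h: "cadj \<sigma> = \<sigma>" using \<sigma>_pos by (simp add: pos_def_def)
  show 1: "\<sigma> ** V j = exp (- \<omega> j) *\<^sub>R (V j ** \<sigma>)"
    using form assms by (intro modular_op_eigenvector[OF \<sigma>_pos]) (simp add: standard_form_def)
  have "cadj (V j) ** \<sigma> = exp (- \<omega> j) *\<^sub>R (\<sigma> ** cadj (V j))"
    using arg_cong[OF 1, of cadj] by (simp add: cadj_mult cadj_scaleR h)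
  then show "\<sigma> ** cadj (V j) = exp (\<omega> j) *\<^sub>R (cadj (V j) ** \<sigma>)"
    by (simp flip: exp_add)
qed

lemma V_orthonormal: "j \<in> J \<Longrightarrow> k \<in> J \<Longrightarrow> tau (cadj (V j) ** V k) = (if j = k then 1 else 0)"
  using form by (simp add: standard_form_def)

lemma V_nonzero: "j \<in> J \<Longrightarrow> V j \<noteq> 0"
  using V_orthonormal[of j j] by (auto simp: mm.zero_right tau_def trace_def)

lemma inj_V: "inj_on V J"
proof (rule inj_onI)
  fix j k assume jk: "j \<in> J" "k \<in> J" "V j = V k"
  then show "j = k" using V_orthonormal[of j k] V_orthonormal[of k k] by (auto split: if_splits)
qed

text \<open>The family of the \<open>V j\<close> is closed under adjoints, and taking adjoints changes the sign
  of the Bohr frequency.\<close>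

lemma sum_adjoint_index:
  "(\<Sum>j\<in>J. F (\<omega> j) (V j) (cadj (V j))) = (\<Sum>j\<in>J. F (- \<omega> j) (cadj (V j)) (V j))"
proof -
  \<comment> \<open>\<open>r\<close> sends an index to that of the adjoint matrix; it is an
    involution because \<open>V\<close> is injective on \<open>J\<close>.\<close>
  define r where "r = (\<lambda>j. inv_into J V (cadj (V j)))"
  have im: "cadj (V j) \<in> V ` J" if "j \<in> J" for j
    using form that by (auto simp: standard_form_def)
  have r: "r j \<in> J" "V (r j) = cadj (V j)" if "j \<in> J" for j
    using im[OF that] by (auto simp: r_def inv_into_into f_inv_into_f)
  have rr: "r (r j) = j" if "j \<in> J" for j
    using r[OF that] r[OF r(1)[OF that]] that inj_V by (auto dest: inj_onD)
  have \<omega>r: "\<omega> (r j) = - \<omega> j" if j: "j \<in> J" for j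
  proof -
    \<comment> \<open>\<open>V (r j)\<close> and \<open>cadj (V j)\<close> are the same matrix, so
      its two eigenvalue relations must agree; invertibility of \<open>\<sigma>\<close> excludes a
      zero factor.\<close>
    have "exp (- \<omega> (r j)) *\<^sub>R (cadj (V j) ** \<sigma>) = exp (\<omega> j) *\<^sub>R (cadj (V j) ** \<sigma>)"
      using V_intertwine(1)[OF r(1)[OF j]] unfolding r(2)[OF j] V_intertwine(2)[OF j] by (rule sym)
    moreover have "cadj (V j) ** \<sigma> \<noteq> 0"
    proof
      assume "cadj (V j) ** \<sigma> = 0"
      then have "cadj (V j) ** (\<sigma> ** mat_fun inverse \<sigma>) = 0"
        by (simp add: matrix_mul_assoc mm.zero_left)
      then have "cadj (V j) = 0" by (simp add: pos_def_mult_inverse[OF \<sigma>_pos])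
      then show False using V_nonzero[OF r(1)[OF j]] r(2)[OF j] by simp
    qed
    ultimately have "exp (- \<omega> (r j)) = exp (\<omega> j)"
      unfolding scaleR_cancel_right by (simp only: simp_thms)
    then show ?thesis by simp
  qed
  show ?thesis
    by (rule sum.reindex_bij_witness[of J r r]) (simp_all only: r rr \<omega>r cadj_cadj minus_minus)
qed

lemma L_eq:
  "A \<in> \<A> \<Longrightarrow> L A = (\<Sum>j\<in>J. exp (- \<omega> j / 2) *\<^sub>R
    (cadj (V j) ** commutator A (V j) + commutator (cadj (V j)) A ** V j))"
  using form by (simp add: standard_form_def)

text \<open>Reindexing the second half by adjoints makes \<open>commutator (V j) A\<close> a factor
  of every term, so \<open>L\<close> annihilates elements that commute with all
  \<open>V j\<close>.\<close>

lemma L_eq':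
  assumes "A \<in> \<A>"
  shows "L A = (\<Sum>j\<in>J. exp (\<omega> j / 2) *\<^sub>R (commutator (V j) A ** cadj (V j))
    - exp (- \<omega> j / 2) *\<^sub>R (cadj (V j) ** commutator (V j) A))"
proof -
  have "(\<Sum>j\<in>J. exp (- \<omega> j / 2) *\<^sub>R (commutator (cadj (V j)) A ** V j)) =
      (\<Sum>j\<in>J. exp (\<omega> j / 2) *\<^sub>R (commutator (V j) A ** cadj (V j)))"
    using sum_adjoint_index[of "\<lambda>w X Y. exp (w / 2) *\<^sub>R (commutator X A ** Y)"] by simp
  moreover have "cadj (V j) ** commutator A (V j) = - (cadj (V j) ** commutator (V j) A)" for j
    by (simp add: commutator_def mm_simps)
  ultimately show ?thesis
    unfolding L_eq[OF assms] scaleR_add_right sum.distrib sum_subtractf by (simp add: sum_negf)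
qed

text \<open>Up to a factor \<open>- 2\<close>, the case \<open>s = - 1/2\<close> is the carre du champ
  \<open>L (A ** B) - A ** L B - L A ** B\<close>.\<close>

definition Gam :: "real \<Rightarrow> 'n cmat \<Rightarrow> 'n cmat \<Rightarrow> 'n cmat" where
  "Gam s A B = (\<Sum>j\<in>J. exp (s * \<omega> j) *\<^sub>R (commutator (cadj (V j)) A ** commutator (V j) B))"

lemma Gam_half_mem:
  assumes A: "A \<in> \<A>" and B: "B \<in> \<A>"
  shows "Gam (- 1/2) A B \<in> \<A>"
proof -
  have AB: "A ** B \<in> \<A>" using A B by (rule mult_mem)
  \<comment> \<open>The failure of the Leibniz rule for one summand; \<open>X\<close> and
    \<open>Y\<close> stand for \<open>cadj (V j)\<close> and \<open>V j\<close>.\<close>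
  have expand: "(X ** commutator (A ** B) Y + commutator X (A ** B) ** Y)
      - A ** (X ** commutator B Y + commutator X B ** Y)
      - (X ** commutator A Y + commutator X A ** Y) ** B
      = (- 2) *\<^sub>R (commutator X A ** commutator Y B)" for X Y :: "'n cmat"
  proof -
    have "(- 2) *\<^sub>R M = - (M + M)" for M :: "'n cmat"
      by (metis scaleR_2 scaleR_minus_left)
    then show ?thesis by (simp only: commutator_def mm_simps) (simp add: algebra_simps)
  qed
  have "L (A ** B) - A ** L B - L A ** B = (- 2) *\<^sub>R Gam (- 1/2) A B"
    unfolding L_eq[OF A] L_eq[OF B] L_eq[OF AB] Gam_def mm.sum_right mm.sum_left
      sum_subtractf[symmetric] mm.scaleR_left mm.scaleR_right scaleR_sum_right
      scaleR_diff_right[symmetric] expand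
    by (simp add: mult.commute)
  moreover have "L (A ** B) - A ** L B - L A ** B \<in> \<A>"
    using A B AB by (intro mems L_mem)
  ultimately have "(- 1/2) *\<^sub>R ((- 2) *\<^sub>R Gam (- 1/2) A B) \<in> \<A>"
    using scaleR_mem by metis
  then show ?thesis by simp
qed

lemma powr_V:
  assumes j: "j \<in> J"
  shows "mat_powr \<sigma> s ** cadj (V j) = exp (s * \<omega> j) *\<^sub>R (cadj (V j) ** mat_powr \<sigma> s)"
    and "exp (s * \<omega> j) *\<^sub>R cadj (V j) = mat_powr \<sigma> s ** cadj (V j) ** mat_powr \<sigma> (- s)"
proof -
  show 1: "mat_powr \<sigma> s ** cadj (V j) = exp (s * \<omega> j) *\<^sub>R (cadj (V j) ** mat_powr \<sigma> s)"
    using mat_powr_intertwine[OF \<sigma>_pos V_intertwine(2)[OF j]] by (simp add: mult.commute)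
  show "exp (s * \<omega> j) *\<^sub>R cadj (V j) = mat_powr \<sigma> s ** cadj (V j) ** mat_powr \<sigma> (- s)"
    unfolding 1 mm.scaleR_left matrix_mul_assoc[symmetric] mat_powr_minus_inverse[OF \<sigma>_pos] by simp
qed

text \<open>Conjugation by a power of \<open>\<sigma>\<close>, itself in \<open>\<A>\<close>,
  multiplies \<open>cadj (V j)\<close> by a power of \<open>exp (\<omega> j)\<close> and thereby
  changes the weight.\<close>

lemma Gam_mem:
  assumes A: "A \<in> \<A>" and B: "B \<in> \<A>"
  shows "Gam s A B \<in> \<A>"
proof -
  \<comment> \<open>The gap between the wanted weight \<open>s\<close> and the weight
    \<open>- 1/2\<close>, for which membership comes from \<open>L\<close>.\<close>
  define c where "c = s + 1/2"
  define Q where "Q = mat_powr \<sigma> c"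
  define Q' where "Q' = mat_powr \<sigma> (- c)"
  have Q: "Q \<in> \<A>" "Q' \<in> \<A>" unfolding Q_def Q'_def by (intro mat_powr_mem \<sigma>_mem \<sigma>_pos)+
  have QQ: "Q ** Q' = mat 1" unfolding Q_def Q'_def by (rule mat_powr_minus_inverse[OF \<sigma>_pos])
  then have QQ': "M ** Q ** Q' = M" for M by (simp flip: matrix_mul_assoc)
  have "exp (s * \<omega> j) *\<^sub>R (commutator (cadj (V j)) A ** commutator (V j) B) =
      Q ** (exp (- 1/2 * \<omega> j) *\<^sub>R (commutator (cadj (V j)) (Q' ** A ** Q) ** commutator (V j) (Q' ** B)))
      - Q ** (exp (- 1/2 * \<omega> j) *\<^sub>R (commutator (cadj (V j)) (Q' ** A ** Q) ** commutator (V j) Q')) ** B"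
    (is "?l = ?r") if j: "j \<in> J" for j
  proof -
    have QV: "Q ** cadj (V j) = exp (c * \<omega> j) *\<^sub>R (cadj (V j) ** Q)"
      unfolding Q_def by (rule powr_V(1)[OF j])
    have "Q ** commutator (cadj (V j)) (Q' ** A ** Q) ** Q'
        = (Q ** cadj (V j)) ** Q' ** A ** (Q ** Q') - (Q ** Q') ** A ** (Q ** cadj (V j)) ** Q'"
      by (simp add: commutator_def mm_simps)
    also have "\<dots> = exp (c * \<omega> j) *\<^sub>R commutator (cadj (V j)) A"
      unfolding QV by (simp add: QQ QQ' commutator_def mm_simps scaleR_diff_right)
    finally have 1: "Q ** commutator (cadj (V j)) (Q' ** A ** Q) ** Q'
        = exp (c * \<omega> j) *\<^sub>R commutator (cadj (V j)) A" .
    \<comment> \<open>The conjugation needs a factor \<open>Q'\<close> in front of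
      \<open>commutator (V j) B\<close>; the Leibniz rule writes that product through commutators of
      elements of \<open>\<A>\<close>.\<close>
    have "commutator (V j) (Q' ** B) - commutator (V j) Q' ** B = Q' ** commutator (V j) B"
      by (simp add: commutator_def mm_simps)
    then have "?r = exp (- 1/2 * \<omega> j) *\<^sub>R
        (Q ** commutator (cadj (V j)) (Q' ** A ** Q) ** (Q' ** commutator (V j) B))"
      by (simp add: mm_simps flip: scaleR_diff_right) (simp flip: matrix_mul_assoc mm.diff_right)
    also have "\<dots> = (exp (- 1/2 * \<omega> j) * exp (c * \<omega> j)) *\<^sub>R
        (commutator (cadj (V j)) A ** commutator (V j) B)"
      unfolding matrix_mul_assoc 1 by (simp add: mm_simps)
    also have "exp (- 1/2 * \<omega> j) * exp (c * \<omega> j) = exp (s * \<omega> j)"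
      by (simp add: c_def algebra_simps flip: exp_add)
    finally show ?thesis by simp
  qed
  then have eq: "Gam s A B = Q ** Gam (- 1/2) (Q' ** A ** Q) (Q' ** B)
      - Q ** Gam (- 1/2) (Q' ** A ** Q) Q' ** B"
    unfolding Gam_def mm.sum_right mm.sum_left sum_subtractf[symmetric] by (intro sum.cong) auto
  show ?thesis unfolding eq by (intro mems Gam_half_mem A B Q)
qed

text \<open>The Leibniz rule absorbs the middle factor \<open>C\<close> into commutators with
  \<open>V j\<close>; the second claim is the first at \<open>- s\<close>, read over adjoint
  indices.\<close>

lemma sum_commutators_mem:
  assumes A: "A \<in> \<A>" and B: "B \<in> \<A>" and C: "C \<in> \<A>"
  shows "(\<Sum>j\<in>J. exp (s * \<omega> j) *\<^sub>R (commutator (cadj (V j)) A ** C ** commutator (V j) B)) \<in> \<A>"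
    and "(\<Sum>j\<in>J. exp (s * \<omega> j) *\<^sub>R (commutator (V j) A ** C ** commutator (cadj (V j)) B)) \<in> \<A>"
proof -
  have "X ** C ** commutator Y B = X ** commutator Y (C ** B) - X ** commutator Y C ** B"
    for X Y :: "'n cmat"
    by (simp add: commutator_def mm_simps)
  then have "(\<Sum>j\<in>J. exp (s * \<omega> j) *\<^sub>R (commutator (cadj (V j)) A ** C ** commutator (V j) B))
      = Gam s A (C ** B) - Gam s A C ** B" for s
    by (simp add: Gam_def mm.sum_left mm.scaleR_left scaleR_diff_right sum_subtractf)
  then have 1: "(\<Sum>j\<in>J. exp (s * \<omega> j) *\<^sub>R (commutator (cadj (V j)) A ** C ** commutator (V j) B)) \<in> \<A>"
    for s
    using A B C by (auto intro!: mems Gam_mem)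
  show "(\<Sum>j\<in>J. exp (s * \<omega> j) *\<^sub>R (commutator (cadj (V j)) A ** C ** commutator (V j) B)) \<in> \<A>"
    by (rule 1)
  show "(\<Sum>j\<in>J. exp (s * \<omega> j) *\<^sub>R (commutator (V j) A ** C ** commutator (cadj (V j)) B)) \<in> \<A>"
    using sum_adjoint_index[of "\<lambda>w X Y. exp (s * w) *\<^sub>R (commutator X A ** C ** commutator Y B)"]
      1[of "- s"] by simp
qed

text \<open>Changing the weights of a sum over \<open>j\<close> only costs an element of \<open>\<A>\<close>:
  \<open>(exp (s * \<omega> j) - 1) (V j)\<^sup>*\<close> is the commutator of \<open>\<sigma>\<^sup>s\<close> and \<open>(V j)\<^sup>*\<close>, times \<open>\<sigma>\<^sup>-\<^sup>s\<close>.\<close>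

lemma sum_double_commutator_mem:
  assumes U: "U \<in> \<A>"
  shows "(\<Sum>j\<in>J. exp (s * \<omega> j) *\<^sub>R commutator (commutator (V j) U) (cadj (V j))) \<in> \<A>"
proof -
  \<comment> \<open>\<open>P\<close> and \<open>R\<close> measure, for the two products in the
    double commutator, the effect of replacing weight 1 by
    \<open>exp (a * \<omega> j)\<close>.\<close>
  define P where "P a = (\<Sum>j\<in>J. (exp (a * \<omega> j) - 1) *\<^sub>R (commutator (V j) U ** cadj (V j)))" for a
  define R where "R a = (\<Sum>j\<in>J. (exp (a * \<omega> j) - 1) *\<^sub>R (cadj (V j) ** commutator (V j) U))" for a
  have PR: "P a \<in> \<A>" "R a \<in> \<A>" for a
  proof -
    let ?Q = "mat_powr \<sigma> a" and ?Q' = "mat_powr \<sigma> (- a)"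
    have Q: "?Q \<in> \<A>" "?Q' \<in> \<A>" by (intro mat_powr_mem \<sigma>_mem \<sigma>_pos)+
    have w: "(exp (a * \<omega> j) - 1) *\<^sub>R cadj (V j) = - (commutator (cadj (V j)) ?Q ** ?Q')"
      if "j \<in> J" for j
    proof -
      have "(exp (a * \<omega> j) - 1) *\<^sub>R cadj (V j) = ?Q ** cadj (V j) ** ?Q' - cadj (V j) ** (?Q ** ?Q')"
        using powr_V(2)[OF that, of a] mat_powr_minus_inverse[OF \<sigma>_pos, of a]
        by (simp add: scaleR_diff_left)
      then show ?thesis by (simp add: commutator_def mm_simps)
    qed
    \<comment> \<open>The trivial weight and the factor \<open>mat 1\<close> bring the sum into the
      shape of \<open>sum_commutators_mem\<close>.\<close>
    have P: "P a = - (\<Sum>j\<in>J. exp (0 * \<omega> j) *\<^sub>R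
        (commutator (V j) U ** mat 1 ** commutator (cadj (V j)) ?Q)) ** ?Q'"
      unfolding P_def mm.scaleR_right[symmetric] mm.sum_left sum_negf[symmetric]
      by (intro sum.cong refl) (simp add: w mm_simps)
    show "P a \<in> \<A>" unfolding P by (intro mems sum_commutators_mem Q U)
    have R: "R a = - (\<Sum>j\<in>J. exp (0 * \<omega> j) *\<^sub>R
        (commutator (cadj (V j)) ?Q ** ?Q' ** commutator (V j) U))"
      unfolding R_def mm.scaleR_left[symmetric] sum_negf[symmetric]
      by (intro sum.cong refl) (simp add: w mm_simps)
    show "R a \<in> \<A>" unfolding R by (intro mems sum_commutators_mem Q U)
  qed
  \<comment> \<open>In \<open>L_eq'\<close> the two products carry the weights
    \<open>exp (\<omega> j / 2)\<close> and \<open>exp (- \<omega> j / 2)\<close>; the differences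
    of \<open>P\<close> and of \<open>R\<close> bring both to
    \<open>exp (s * \<omega> j)\<close>.\<close>
  have "(\<Sum>j\<in>J. exp (s * \<omega> j) *\<^sub>R commutator (commutator (V j) U) (cadj (V j)))
      = L U + (P s - P (1/2)) - (R s - R (- 1/2))"
    unfolding P_def R_def L_eq'[OF U] sum_subtractf[symmetric] sum.distrib[symmetric]
    by (intro sum.cong refl)
       (simp add: commutator_def[of "commutator _ _"] algebra_simps scaleR_diff_left)
  then show ?thesis using PR U by (auto intro!: mems L_mem)
qed

text \<open>The Leibniz rule for the outer commutator leaves a double commutator between
  \<open>R\<close> and \<open>S\<close> and two sums of products of commutators, each already known
  to lie in \<open>\<A>\<close>.\<close>

lemma sum_weighted_divergence_mem:
  assumes R: "R \<in> \<A>" and S: "S \<in> \<A>" and U: "U \<in> \<A>"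
  shows "(\<Sum>j\<in>J. commutator (exp (\<omega> j * s) *\<^sub>R (R ** commutator (V j) U ** S)) (cadj (V j))) \<in> \<A>"
proof -
  have expand: "commutator (R ** K ** S) X = R ** commutator K X ** S
      - R ** (K ** mat 1 ** commutator X S) - (commutator X R ** mat 1 ** K) ** S"
    for K X :: "'n cmat"
    by (simp add: commutator_def mm_simps)
  have eq: "(\<Sum>j\<in>J. commutator (exp (\<omega> j * s) *\<^sub>R (R ** commutator (V j) U ** S)) (cadj (V j)))
      = R ** (\<Sum>j\<in>J. exp (s * \<omega> j) *\<^sub>R commutator (commutator (V j) U) (cadj (V j))) ** S
      - R ** (\<Sum>j\<in>J. exp (s * \<omega> j) *\<^sub>R (commutator (V j) U ** mat 1 ** commutator (cadj (V j)) S))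
      - (\<Sum>j\<in>J. exp (s * \<omega> j) *\<^sub>R (commutator (cadj (V j)) R ** mat 1 ** commutator (V j) U)) ** S"
    unfolding mm.sum_right mm.sum_left sum_subtractf[symmetric]
    by (intro sum.cong refl)
       (simp only: linear_cmul[OF linear_commutator_left] expand mm.scaleR_left mm.scaleR_right
          scaleR_diff_right mult.commute[of s])
  show ?thesis
    unfolding eq by (intro mems sum_commutators_mem sum_double_commutator_mem assms)
qed

section \<open>The flux: weighted divergence of a gradient\<close>

text \<open>The noncommutative analogue of \<open>div (rho grad U)\<close>; its negative is the
  tangent vector assigned to \<open>U\<close>.\<close>

definition flux :: "'n cmat \<Rightarrow> 'n cmat \<Rightarrow> 'n cmat" where
  "flux \<rho> U = (\<Sum>j\<in>J. commutator (weight_op \<rho> (\<omega> j) (commutator (V j) U)) (cadj (V j)))"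

lemma divergence_eq_flux:
  "divergence J V (\<lambda>j. weight_op \<rho> (\<omega> j) (nabla J V U j)) = flux \<rho> U"
  by (simp add: divergence_def flux_def nabla_def)

lemma linear_flux: "pos_def \<rho> \<Longrightarrow> linear (flux \<rho>)"
  unfolding flux_def
  by (intro linear_compose_sum ballI)
     (intro linear_compose[OF linear_compose[OF linear_commutator_right linear_weight_op]
        linear_commutator_left, unfolded o_def])

text \<open>For each fixed \<open>s\<close> the sum over \<open>j\<close> of the integrands lies in
  \<open>\<A>\<close>. Single summands need not, so the sum is taken under the integral.\<close>

lemma flux_mem:
  assumes \<rho>: "\<rho> \<in> \<A>" "pos_def \<rho>" and U: "U \<in> \<A>"
  shows "flux \<rho> U \<in> \<A>"
proof (rule has_integral_in_subspace[OF sub])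
  let ?f = "\<lambda>j s. exp (\<omega> j * (s - 1/2)) *\<^sub>R (mat_powr \<rho> s ** commutator (V j) U ** mat_powr \<rho> (1 - s))"
  show "((\<lambda>s. \<Sum>j\<in>J. commutator (?f j s) (cadj (V j))) has_integral flux \<rho> U) {0..1}"
    unfolding flux_def
    by (intro has_integral_sum finite_J has_integral_linear[unfolded o_def,
          OF has_integral_weight_op[OF \<rho>(2)]])
       (simp add: linear_commutator_left flip: linear_conv_bounded_linear)
  show "(\<Sum>j\<in>J. commutator (?f j s) (cadj (V j))) \<in> \<A>" for s
    by (intro sum_weighted_divergence_mem mat_powr_mem \<rho> U)
qed

text \<open>The adjoint of a summand is the summand for \<open>cadj (V j)\<close> and
  \<open>- \<omega> j\<close>, the signs from the two reversed commutators cancelling; reindexing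
  restores the sum.\<close>

lemma cadj_flux:
  assumes "pos_def \<rho>" "cadj U = U"
  shows "cadj (flux \<rho> U) = flux \<rho> U"
proof -
  have "cadj (commutator (weight_op \<rho> w (commutator X U)) (cadj X))
      = commutator (weight_op \<rho> (- w) (commutator (cadj X) U)) X" for w X
  proof -
    have "commutator U (cadj X) = - commutator (cadj X) U" by (simp add: commutator_def)
    then show ?thesis
      unfolding cadj_commutator cadj_weight_op[OF assms(1)] assms(2)
      by (simp add: linear_neg[OF linear_weight_op[OF assms(1)]]) (simp add: commutator_def mm_simps)
  qed
  then have "cadj (flux \<rho> U)
      = (\<Sum>j\<in>J. commutator (weight_op \<rho> (- \<omega> j) (commutator (cadj (V j)) U)) (V j))"
    by (simp add: flux_def cadj_sum)
  also have "\<dots> = flux \<rho> U"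
    unfolding flux_def
    by (rule sum_adjoint_index[symmetric,
          where F = "\<lambda>w X Y. commutator (weight_op \<rho> w (commutator X U)) Y"])
  finally show ?thesis .
qed

lemma trace_flux: "trace (flux \<rho> U) = 0"
  by (simp add: flux_def trace_sum trace_commutator)

lemma inner_flux:
  "inner A (flux \<rho> U) = - (\<Sum>j\<in>J. inner (commutator (V j) A) (weight_op \<rho> (\<omega> j) (commutator (V j) U)))"
  by (simp add: flux_def inner_sum_right inner_commutator sum_negf)

text \<open>The pairing is minus a sum of the positive definite forms of
  \<open>inner_weight_op\<close>. Uniqueness of tangent fields and surjectivity of the flux both
  rest on this.\<close>

lemma inner_flux_self_eq_0:
  assumes "pos_def \<rho>" "inner U (flux \<rho> U) = 0" "j \<in> J"
  shows "commutator (V j) U = 0"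
proof -
  have "(\<Sum>j\<in>J. inner (commutator (V j) U) (weight_op \<rho> (\<omega> j) (commutator (V j) U))) = 0"
    using assms(2) by (simp add: inner_flux)
  then have "inner (commutator (V j) U) (weight_op \<rho> (\<omega> j) (commutator (V j) U)) = 0"
    by (rule sum_nonneg_0[OF finite_J inner_weight_op(1)[OF assms(1)] _ assms(3)])
  then show ?thesis by (rule inner_weight_op(2)[OF assms(1)])
qed

section \<open>Tangent fields and the metric\<close>

text \<open>Only the field is unique; the potential is fixed up to matrices commuting with all
  \<open>V j\<close>. If two potentials have equal flux, their difference has zero energy and hence
  zero gradient.\<close>

lemma tangent_field_flux:
  assumes \<rho>: "pos_def \<rho>" and U: "U \<in> \<A>" "cadj U = U"
  shows "tangent_field \<A> J V \<omega> \<rho> (- flux \<rho> U) = nabla J V U"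
  unfolding tangent_field_def
proof (rule the_equality)
  show "\<exists>U'\<in>\<A>. cadj U' = U' \<and> nabla J V U = nabla J V U' \<and>
      - flux \<rho> U = - divergence J V (\<lambda>j. weight_op \<rho> (\<omega> j) (nabla J V U j))"
    using U by (auto simp: divergence_eq_flux)
next
  fix W
  assume "\<exists>U'\<in>\<A>. cadj U' = U' \<and> W = nabla J V U' \<and>
      - flux \<rho> U = - divergence J V (\<lambda>j. weight_op \<rho> (\<omega> j) (W j))"
  then obtain U' where W: "W = nabla J V U'" and eq: "flux \<rho> U = flux \<rho> U'"
    by (auto simp: divergence_eq_flux)
  have "flux \<rho> (U - U') = 0" using eq by (simp add: linear_diff[OF linear_flux[OF \<rho>]])
  then have "commutator (V j) (U - U') = 0" if "j \<in> J" for j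
    by (intro inner_flux_self_eq_0[OF \<rho> _ that]) simp
  then have "commutator (V j) U = commutator (V j) U'" if "j \<in> J" for j
    using that by (simp add: linear_diff[OF linear_commutator_right])
  then show "W = nabla J V U" unfolding W nabla_def by (intro restrict_ext) simp
qed

text \<open>\<open>CARD('n)\<close> is the trace of the identity and undoes the normalization of
  \<open>tau\<close>. Integration by parts turns the pairing of two gradients into that of a
  potential with a tangent vector.\<close>

lemma metric_L_flux:
  assumes \<rho>: "pos_def \<rho>" and U: "U \<in> \<A>" "cadj U = U" and U': "U' \<in> \<A>" "cadj U' = U'"
  shows "of_nat CARD('n) * metric_L \<A> J V \<omega> \<rho> (- flux \<rho> U) (- flux \<rho> U') = inner U (- flux \<rho> U')"
proof -
  have "Re (inner_H A B) = inner A B / of_nat CARD('n)" for A B :: "'n cmat"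
    by (simp add: inner_H_eq inner_eq_trace)
  then have "metric_L \<A> J V \<omega> \<rho> (- flux \<rho> U) (- flux \<rho> U') =
      (\<Sum>j\<in>J. inner (commutator (V j) U) (weight_op \<rho> (\<omega> j) (commutator (V j) U'))) / of_nat CARD('n)"
    by (simp add: metric_L_def tangent_field_flux[OF \<rho>] U U' vf_inner_def nabla_def
        flip: sum_divide_distrib)
  then show ?thesis by (simp add: inner_flux)
qed

section \<open>The adjoint generator as a flux\<close>

text \<open>A noncommutative chain rule. On the block of \<open>x\<close> and \<open>y\<close> the
  commutator contributes \<open>ln y - ln x - \<omega> j\<close>, which
  \<open>weight_coeff_mult\<close> turns into an expression linear in \<open>x\<close> and
  \<open>y\<close>.\<close>

lemma weight_op_commutator_log:
  assumes \<rho>: "pos_def \<rho>" and j: "j \<in> J"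
  shows "weight_op \<rho> (\<omega> j) (commutator (V j) (mat_ln \<rho> - mat_ln \<sigma>))
    = exp (- \<omega> j / 2) *\<^sub>R (V j ** \<rho>) - exp (\<omega> j / 2) *\<^sub>R (\<rho> ** V j)"
proof -
  have h: "cadj \<rho> = \<rho>" using \<rho> by (simp add: pos_def_def)
  let ?E = "spec_proj \<rho>" and ?S = "eigvals \<rho>"
  define w where "w = \<omega> j"
  define X where "X = V j"
  have 1: "commutator X (mat_ln \<rho> - mat_ln \<sigma>) = X ** mat_ln \<rho> - mat_ln \<rho> ** X - w *\<^sub>R X"
    using mat_ln_intertwine[OF \<sigma>_pos V_intertwine(1)[OF j]]
    unfolding X_def w_def linear_diff[OF linear_commutator_right]
    by (simp add: commutator_def)
  have lnE: "mat_ln \<rho> ** ?E y = ln y *\<^sub>R ?E y" "?E y ** mat_ln \<rho> = ln y *\<^sub>R ?E y" for y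
    unfolding mat_ln_def spec_proj_def mat_fun_mult[OF h] mat_fun_scaleR[OF h]
    by (auto intro: mat_fun_cong[OF h])
  have c: "?E x ** commutator X (mat_ln \<rho> - mat_ln \<sigma>) ** ?E y
      = (ln y - ln x - w) *\<^sub>R (?E x ** X ** ?E y)" for x y
  proof -
    have "?E x ** commutator X (mat_ln \<rho> - mat_ln \<sigma>) ** ?E y
        = ?E x ** X ** (mat_ln \<rho> ** ?E y) - (?E x ** mat_ln \<rho>) ** X ** ?E y - w *\<^sub>R (?E x ** X ** ?E y)"
      unfolding 1 by (simp add: mm_simps)
    then show ?thesis unfolding lnE by (simp add: mm_simps scaleR_diff_left)
  qed
  have "weight_op \<rho> w (commutator X (mat_ln \<rho> - mat_ln \<sigma>))
      = (\<Sum>x\<in>?S. \<Sum>y\<in>?S. (exp (- w / 2) * y - exp (w / 2) * x) *\<^sub>R (?E x ** X ** ?E y))"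
    unfolding weight_op_eq_sum[OF \<rho>] c scaleR_scaleR
    by (intro sum.cong refl) (simp add: weight_coeff_mult pos_def_eigvals[OF \<rho>])
  also have "\<dots> = exp (- w / 2) *\<^sub>R (X ** mat_fun (\<lambda>x. x) \<rho>) - exp (w / 2) *\<^sub>R (mat_fun (\<lambda>x. x) \<rho> ** X)"
    unfolding mat_fun_mult_left[OF h] mat_fun_mult_right[OF h]
    by (simp add: scaleR_sum_right scaleR_diff_left sum_subtractf)
  finally show ?thesis by (simp add: mat_fun_ident[OF h] w_def X_def)
qed

text \<open>Adjoint indices in one half of \<open>L\<close> and cyclicity of the trace move all
  commutators onto \<open>V j ** \<rho>\<close> and \<open>\<rho> ** V j\<close>, the two terms of
  \<open>weight_op_commutator_log\<close>.\<close>

lemma dagger_L_eq_flux: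
  assumes \<rho>: "\<rho> \<in> \<A>" "pos_def \<rho>"
  shows "dagger \<A> L \<rho> = flux \<rho> (mat_ln \<rho> - mat_ln \<sigma>)"
proof -
  define U where "U = mat_ln \<rho> - mat_ln \<sigma>"
  have h: "cadj \<rho> = \<rho>" using \<rho> by (simp add: pos_def_def)
  have U: "U \<in> \<A>" "cadj U = U"
    unfolding U_def by (rule log_diff_mem[OF \<rho>])+
  have F: "flux \<rho> U \<in> \<A>" "cadj (flux \<rho> U) = flux \<rho> U"
    by (intro flux_mem \<rho> U cadj_flux)+
  have adj: "inner_H (flux \<rho> U) C = inner_H \<rho> (L C)" if C: "C \<in> \<A>" for C
  proof -
    have t1: "trace (\<rho> ** (commutator Y C ** X)) = trace (commutator (X ** \<rho>) Y ** C)" for X Y :: "'n cmat"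
    proof -
      have "trace (\<rho> ** Y ** C ** X) = trace (X ** (\<rho> ** Y ** C))"
        "trace (\<rho> ** C ** Y ** X) = trace ((Y ** X) ** (\<rho> ** C))"
        by (metis trace_mul_sym) (metis trace_mul_sym matrix_mul_assoc)
      then show ?thesis by (simp add: commutator_def mm_simps trace_sub)
    qed
    have t2: "trace (\<rho> ** (X ** commutator C Y)) = - trace (commutator (\<rho> ** X) Y ** C)" for X Y :: "'n cmat"
    proof -
      have "trace (\<rho> ** X ** C ** Y) = trace (Y ** (\<rho> ** X ** C))"
        by (rule trace_mul_sym)
      then show ?thesis by (simp add: commutator_def mm_simps trace_sub)
    qed
    have "trace (\<rho> ** L C) = (\<Sum>j\<in>J. exp (- \<omega> j / 2) *\<^sub>R trace (\<rho> ** (cadj (V j) ** commutator C (V j))))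
        + (\<Sum>j\<in>J. exp (- \<omega> j / 2) *\<^sub>R trace (\<rho> ** (commutator (cadj (V j)) C ** V j)))"
      unfolding L_eq[OF C] mm.sum_right mm.scaleR_right mm.add_right trace_sum trace_scaleR trace_add
        scaleR_add_right sum.distrib ..
    also have "(\<Sum>j\<in>J. exp (- \<omega> j / 2) *\<^sub>R trace (\<rho> ** (cadj (V j) ** commutator C (V j))))
        = (\<Sum>j\<in>J. exp (\<omega> j / 2) *\<^sub>R trace (\<rho> ** (V j ** commutator C (cadj (V j)))))"
      using sum_adjoint_index[of "\<lambda>w X Y. exp (w / 2) *\<^sub>R trace (\<rho> ** (X ** commutator C Y))"] by simp
    also have "\<dots> + (\<Sum>j\<in>J. exp (- \<omega> j / 2) *\<^sub>R trace (\<rho> ** (commutator (cadj (V j)) C ** V j)))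
        = (\<Sum>j\<in>J. exp (- \<omega> j / 2) *\<^sub>R trace (commutator (V j ** \<rho>) (cadj (V j)) ** C)
            - exp (\<omega> j / 2) *\<^sub>R trace (commutator (\<rho> ** V j) (cadj (V j)) ** C))"
      unfolding t1 t2 by (simp add: sum_negf sum_subtractf)
    also have "\<dots> = trace (flux \<rho> U ** C)"
      by (simp add: flux_def U_def weight_op_commutator_log \<rho> mm.sum_left trace_sum
          linear_diff[OF linear_commutator_left] linear_cmul[OF linear_commutator_left]
          mm.diff_left mm.scaleR_left trace_sub trace_scaleR)
    finally show ?thesis by (simp add: inner_H_eq h F(2))
  qed
  show ?thesis
    unfolding dagger_def U_def[symmetric]
  proof (rule the_equality)
    show "flux \<rho> U \<in> \<A> \<and> (\<forall>C\<in>\<A>. inner_H (flux \<rho> U) C = inner_H \<rho> (L C))"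
      using F adj by blast
  next
    fix B assume B: "B \<in> \<A> \<and> (\<forall>C\<in>\<A>. inner_H B C = inner_H \<rho> (L C))"
    \<comment> \<open>Both candidates lie in \<open>\<A>\<close>, so their difference is an
      admissible test element and is orthogonal to itself.\<close>
    define D where "D = B - flux \<rho> U"
    have "D \<in> \<A>" unfolding D_def using B F by (intro mems) auto
    then have "inner_H B D = inner_H (flux \<rho> U) D" using B adj by simp
    then have "trace (cadj B ** D) = trace (cadj (flux \<rho> U) ** D)" by (simp add: inner_H_eq)
    then have "trace (cadj D ** D) = 0"
      by (simp add: D_def cadj_diff mm.diff_left trace_sub)
    then have "inner D D = 0" by (simp add: inner_eq_trace)
    then show "B = flux \<rho> U" by (simp add: D_def)
  qed
qed

text \<open>An element of the selfadjoint part of \<open>\<A>\<close> that is orthogonal to the range of the flux is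
  orthogonal to its own image, hence commutes with all \<open>V j\<close>, hence is a fixed point.\<close>

lemma flux_surj:
  assumes semi: "exp_semigroup \<A> L P" and erg: "ergodic \<A> P"
    and \<rho>: "\<rho> \<in> \<A>" "pos_def \<rho>"
    and X: "X \<in> \<A>" "cadj X = X" "trace X = 0"
  obtains U where "U \<in> \<A>" "cadj U = U" "X = - flux \<rho> U"
proof -
  define H where "H = {A \<in> \<A>. cadj A = A}"
  have H: "subspace H"
    unfolding H_def subspace_def using sub
    by (auto simp: subspace_def cadj_add cadj_scaleR)
  \<comment> \<open>The image of the selfadjoint part is a real subspace, so \<open>X\<close> splits
    into a flux \<open>y\<close> and a part \<open>z\<close> orthogonal to all fluxes; the aim is
    \<open>z = 0\<close>.\<close>
  have R: "subspace (flux \<rho> ` H)" by (rule linear_subspace_image[OF linear_flux[OF \<rho>(2)] H])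
  obtain y z where y: "y \<in> span (flux \<rho> ` H)"
    and z: "\<And>w. w \<in> span (flux \<rho> ` H) \<Longrightarrow> orthogonal z w" and Xyz: "X = y + z"
    using orthogonal_subspace_decomp_exists[of "flux \<rho> ` H" X] by blast
  obtain U where U: "U \<in> H" "y = flux \<rho> U" using y R by (auto simp: span_eq_iff[THEN iffD2])
  have yH: "y \<in> H" using U flux_mem[OF \<rho>] cadj_flux[OF \<rho>(2)] by (auto simp: H_def)
  have "z = X - y" by (simp add: Xyz)
  then have zH: "z \<in> H" using X yH H by (auto simp: H_def intro: mems simp: cadj_diff)
  have "inner z (flux \<rho> z) = 0"
    using z[OF span_base[OF imageI[OF zH]]] by (simp add: orthogonal_def)
  then have comm: "commutator (V j) z = 0" if "j \<in> J" for j
    using inner_flux_self_eq_0[OF \<rho>(2) _ that] by blast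
  have z\<A>: "z \<in> \<A>" using zH by (simp add: H_def)
  have Lz: "L z = 0" unfolding L_eq'[OF z\<A>] by (simp add: comm mm.zero_left mm.zero_right)
  have L0: "L 0 = 0" unfolding L_eq'[OF zero_mem] by (simp add: commutator_def mm_simps)
  \<comment> \<open>Only the zeroth term of the exponential series at \<open>z\<close> survives,
    hence \<open>P 1\<close> fixes \<open>z\<close> and ergodicity makes it scalar.\<close>
  have iter: "(L ^^ k) z = (if k = 0 then z else 0)" for k
    by (induction k) (auto simp: Lz L0)
  have "(\<lambda>k. (t ^ k / fact k) *\<^sub>R (L ^^ k) z) sums P t z" if "t \<ge> 0" for t
    using semi z\<A> that by (simp add: exp_semigroup_def)
  from this[OF zero_le_one] have "(\<lambda>k. (1 ^ k / fact k) *\<^sub>R (L ^^ k) z) sums P 1 z" .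
  moreover have "(\<lambda>k. (1 ^ k / fact k) *\<^sub>R (L ^^ k) z) sums z"
    using sums_finite[of "{0}" "\<lambda>k. (1 ^ k / fact k) *\<^sub>R (L ^^ k) z"] by (simp add: iter)
  ultimately have "P 1 z = z" by (rule sums_unique2)
  moreover have "{A \<in> \<A>. P 1 A = A} = range mat" using erg zero_less_one unfolding ergodic_def by blast
  ultimately have "z \<in> range mat" using z\<A> by auto
  then obtain c where c: "z = mat c" by blast
  \<comment> \<open>A scalar matrix is orthogonal to the traceless \<open>X\<close>. As
    \<open>z\<close> is also orthogonal to \<open>y\<close> and \<open>X = y + z\<close>, it is
    orthogonal to itself.\<close>
  have "cadj z ** X = mat (cnj c) ** X" by (simp add: c)
  moreover have "trace (mat a ** M) = a * trace M" for a and M :: "'n cmat"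
    by (simp add: trace_def matrix_matrix_mult_def mat_def if_distrib[of "\<lambda>x. x * _"]
        sum_distrib_left cong: if_cong)
  ultimately have "inner z X = 0" by (simp add: inner_eq_trace X)
  moreover have "inner z y = 0" using z[OF y] by (simp add: orthogonal_def)
  ultimately have "z = 0" by (simp add: Xyz inner_add_right)
  then have "X = - flux \<rho> (- U)"
    using Xyz U by (simp add: linear_neg[OF linear_flux[OF \<rho>(2)]])
  moreover have "- U \<in> \<A>" "cadj (- U) = - U"
    using U by (auto simp: H_def cadj_minus intro: mems)
  ultimately show ?thesis using that by blast
qed

end

section \<open>Paths of states and their velocities\<close>

text \<open>The difference quotients at \<open>p\<close> lie in \<open>S\<close>, which is closed,
  hence so does their limit. It is applied to the traceless selfadjoint elements of
  \<open>\<A>\<close>.\<close>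

lemma path_velocity_in_subspace:
  fixes S :: "'a::euclidean_space set"
  assumes S: "subspace S" and \<gamma>: "path_velocity T p \<gamma> X" and diff: "\<And>q. q \<in> T \<Longrightarrow> q - p \<in> S"
  shows "X \<in> S"
proof -
  obtain \<epsilon> where \<epsilon>: "\<epsilon> > 0" "\<And>t. \<bar>t\<bar> < \<epsilon> \<Longrightarrow> \<gamma> t \<in> T" and p: "\<gamma> 0 = p"
    and der: "(\<gamma> has_vector_derivative X) (at 0)"
    using \<gamma> by (auto simp: path_velocity_def)
  have "((\<lambda>t. (\<gamma> t - p) /\<^sub>R t) \<longlongrightarrow> X) (at 0)"
  proof -
    have lim: "((\<lambda>t. norm ((\<gamma> t - p) - t *\<^sub>R X) / \<bar>t\<bar>) \<longlongrightarrow> 0) (at 0)"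
      using der unfolding has_vector_derivative_def has_derivative_at by (simp add: p)
    have eq: "norm ((\<gamma> t - p) - t *\<^sub>R X) / \<bar>t\<bar> = norm ((\<gamma> t - p) /\<^sub>R t - X)" if "t \<noteq> 0" for t
    proof -
      have "(\<gamma> t - p) /\<^sub>R t - X = ((\<gamma> t - p) - t *\<^sub>R X) /\<^sub>R t"
        using that by (simp add: scaleR_diff_right)
      then show ?thesis by (simp add: divide_inverse_commute)
    qed
    have "((\<lambda>t. norm ((\<gamma> t - p) /\<^sub>R t - X)) \<longlongrightarrow> 0) (at 0)"
      by (rule Lim_transform_eventually[OF lim]) (auto simp: eventually_at eq intro: exI[of _ 1])
    then show ?thesis by (simp add: tendsto_norm_zero_iff LIM_zero_iff)
  qed
  moreover have "\<forall>\<^sub>F t in at 0. (\<gamma> t - p) /\<^sub>R t \<in> S"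
  proof -
    have "\<forall>\<^sub>F t in at (0::real). \<bar>t\<bar> < \<epsilon>"
      using \<epsilon>(1) unfolding eventually_at by (auto simp: dist_real_def)
    then show ?thesis
      by eventually_elim (use diff \<epsilon>(2) S in \<open>auto intro: subspace_scale\<close>)
  qed
  ultimately show ?thesis
    using Lim_in_closed_set[OF closed_subspace[OF S]] by (metis at_neq_bot)
qed

text \<open>On the unit sphere the form of \<open>\<rho>\<close> has a positive minimum
  \<open>m\<close> and that of \<open>G\<close> is bounded by \<open>C\<close>, so
  \<open>\<bar>t\<bar> < m / C\<close> suffices; homogeneity covers the other vectors.\<close>

lemma pos_def_perturbation:
  fixes \<rho> G :: "'n::finite cmat"
  assumes \<rho>: "pos_def \<rho>" and G: "cadj G = G"
  obtains \<epsilon> where "\<epsilon> > 0" "\<And>t. \<bar>t\<bar> < \<epsilon> \<Longrightarrow> pos_def (\<rho> + t *\<^sub>R G)"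
proof -
  let ?K = "sphere 0 1 :: (complex^'n) set"
  let ?q = "\<lambda>M v. inner v (M *v v)"
  have cont: "continuous_on ?K (?q M)" for M :: "'n cmat"
    by (intro continuous_intros linear_continuous_on matrix_vector_mul_bounded_linear)
  have q: "Re (sesq v M v) = ?q M v" for M :: "'n cmat" and v
    by (simp add: sesq_eq_hdot inner_eq_Re_hdot)
  have "?K \<noteq> {}" using vector_choose_size[of 1] by auto
  then obtain u where u: "u \<in> ?K" and min: "\<And>v. v \<in> ?K \<Longrightarrow> ?q \<rho> u \<le> ?q \<rho> v"
    using continuous_attains_inf[OF compact_sphere _ cont[of \<rho>]] by blast
  define m where "m = ?q \<rho> u"
  have "u \<noteq> 0" using u by auto
  then have m: "m > 0" using \<rho> unfolding pos_def_def q m_def by auto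
  have "bounded (?q G ` ?K)" by (intro compact_imp_bounded compact_continuous_image cont compact_sphere)
  then obtain C where C: "C > 0" "\<And>v. v \<in> ?K \<Longrightarrow> \<bar>?q G v\<bar> \<le> C"
    unfolding bounded_pos by auto
  show ?thesis
  proof (rule that[of "m / C"])
    show "m / C > 0" using m C by simp
    fix t :: real assume t: "\<bar>t\<bar> < m / C"
    have "cadj (\<rho> + t *\<^sub>R G) = \<rho> + t *\<^sub>R G"
      using \<rho> G by (simp add: pos_def_def cadj_add cadj_scaleR)
    moreover have "?q (\<rho> + t *\<^sub>R G) v > 0" if v: "v \<noteq> 0" for v
    proof -
      define w where "w = v /\<^sub>R norm v"
      have w: "w \<in> ?K" and vw: "v = norm v *\<^sub>R w" using v by (simp_all add: w_def)
      have "\<bar>t * ?q G w\<bar> \<le> \<bar>t\<bar> * C" using C(2)[OF w] by (simp add: abs_mult mult_left_mono)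
      also have "\<dots> < m" using t C(1) by (simp add: field_simps)
      finally have "?q \<rho> w + t * ?q G w > 0" using min[OF w] by (simp add: m_def)
      moreover have "?q (\<rho> + t *\<^sub>R G) v = (norm v)\<^sup>2 * (?q \<rho> w + t * ?q G w)"
        by (subst (1 2) vw) (simp add: matrix_vector_mult_add_rdistrib scaleR_matrix_vector_mult
            matrix_vector_mult_scaleR_complex inner_add_right power2_eq_square algebra_simps)
      ultimately show ?thesis using v by simp
    qed
    ultimately show "pos_def (\<rho> + t *\<^sub>R G)" by (simp add: pos_def_def q)
  qed
qed

section \<open>The gradient of the relative entropy\<close>

theorem theorem7p6:
  fixes \<A> :: "(complex^'n::finite^'n) set"
    and P :: "real \<Rightarrow> complex^'n^'n \<Rightarrow> complex^'n^'n"
    and L :: "complex^'n^'n \<Rightarrow> complex^'n^'n"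
    and \<sigma> :: "complex^'n^'n"
    and J :: "'j set"
    and V :: "'j \<Rightarrow> complex^'n^'n"
    and \<omega> :: "'j \<Rightarrow> real"
  assumes "unital_cstar_subalgebra \<A>"
    and "qms \<A> P"
    and "exp_semigroup \<A> L P"
    and "ergodic \<A> P"
    and "\<sigma> \<in> inv_densities \<A>"
    and "detailed_balance \<A> \<sigma> P"
    and "standard_form \<A> \<sigma> L J V \<omega>"
  shows "gradient_flow (inv_densities \<A>)
           (\<lambda>\<rho> X Y. Re (trace (mat 1 :: complex^'n^'n)) * metric_L \<A> J V \<omega> \<rho> X Y)
           (\<lambda>\<rho>. rel_entropy \<rho> \<sigma>)
           (dagger \<A> L)"
proof -
  interpret standard_generator \<A> \<sigma> L J V \<omega>
    using assms by unfold_locales (auto simp: inv_densities_def exp_semigroup_def linear_op_on_def)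
  show ?thesis
    unfolding gradient_flow_def
  proof
    fix \<rho> assume \<rho>D: "\<rho> \<in> inv_densities \<A>"
    then have \<rho>: "\<rho> \<in> \<A>" "pos_def \<rho>" "trace \<rho> = 1" by (auto simp: inv_densities_def)
    define U where "U = mat_ln \<rho> - mat_ln \<sigma>"
    have U: "U \<in> \<A>" "cadj U = U"
      unfolding U_def by (rule log_diff_mem[OF \<rho>(1,2)])+
    define G where "G = - flux \<rho> U"
    have G: "G \<in> \<A>" "cadj G = G" "trace G = 0"
      using flux_mem[OF \<rho>(1,2) U(1)] cadj_flux[OF \<rho>(2) U(2)]
      by (auto simp: G_def cadj_minus trace_minus trace_flux intro: mems)
    \<comment> \<open>The straight line through \<open>\<rho>\<close> in direction \<open>G\<close>
      is a path of states for small \<open>t\<close>.\<close>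
    have "G \<in> tangent_space (inv_densities \<A>) \<rho>"
    proof -
      obtain \<epsilon> where \<epsilon>: "\<epsilon> > 0" "\<And>t. \<bar>t\<bar> < \<epsilon> \<Longrightarrow> pos_def (\<rho> + t *\<^sub>R G)"
        using pos_def_perturbation[OF \<rho>(2) G(2)] by blast
      have der: "((\<lambda>t. \<rho> + t *\<^sub>R G) has_vector_derivative G) (at t)" for t
        by (auto intro!: derivative_eq_intros)
      have "path_velocity (inv_densities \<A>) \<rho> (\<lambda>t. \<rho> + t *\<^sub>R G) G"
        unfolding path_velocity_def using \<epsilon> der \<rho> G
        by (auto simp: inv_densities_def trace_add trace_scaleR intro!: exI[of _ \<epsilon>] mems
            intro: differentiableI_vector)
      then show ?thesis by (auto simp: tangent_space_def)
    qed
    moreover have "((\<lambda>t. rel_entropy (\<gamma> t) \<sigma>) has_real_derivative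
        Re (trace (mat 1 :: complex^'n^'n)) * metric_L \<A> J V \<omega> \<rho> G X) (at 0)"
      if \<gamma>: "path_velocity (inv_densities \<A>) \<rho> \<gamma> X" for \<gamma> X
    proof -
      obtain \<epsilon> where \<epsilon>: "\<epsilon> > 0" "\<And>t. \<bar>t\<bar> < \<epsilon> \<Longrightarrow> \<gamma> t \<in> inv_densities \<A>"
        and p: "\<gamma> 0 = \<rho>" and der: "(\<gamma> has_vector_derivative X) (at 0)"
        using \<gamma> by (auto simp: path_velocity_def)
      have "subspace {A \<in> \<A>. cadj A = A \<and> trace A = 0}"
        using sub by (auto simp: subspace_def cadj_add cadj_scaleR trace_add trace_scaleR trace_0[simplified])
      then have X: "X \<in> {A \<in> \<A>. cadj A = A \<and> trace A = 0}"
        by (rule path_velocity_in_subspace[OF _ \<gamma>])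
           (use \<rho> in \<open>auto simp: inv_densities_def pos_def_def cadj_diff trace_sub intro: mems\<close>)
      \<comment> \<open>An arbitrary velocity is written as the negative flux of a potential, the
        form in which \<open>metric_L_flux\<close> evaluates the metric.\<close>
      then obtain U' where U': "U' \<in> \<A>" "cadj U' = U'" "X = - flux \<rho> U'"
        using flux_surj[OF assms(3,4) \<rho>(1,2)] by blast
      have "Re (trace (mat 1 :: complex^'n^'n)) * metric_L \<A> J V \<omega> \<rho> G X = inner U X"
        unfolding G_def U'(3) using metric_L_flux[OF \<rho>(2) U U'(1,2)] by (simp add: trace_I)
      also have "\<dots> = Re (trace (X ** U))"
        by (simp add: inner_eq_trace U trace_mul_sym[of U])
      finally show ?thesis
        using rel_entropy_has_derivative[OF der \<epsilon>(1), of \<sigma>] \<epsilon>(2)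
        by (simp add: p U_def inv_densities_def)
    qed
    ultimately have "riemannian_gradient (inv_densities \<A>)
        (\<lambda>\<rho> X Y. Re (trace (mat 1 :: complex^'n^'n)) * metric_L \<A> J V \<omega> \<rho> X Y)
        (\<lambda>\<rho>. rel_entropy \<rho> \<sigma>) \<rho> G"
      by (auto simp: riemannian_gradient_def)
    moreover have "dagger \<A> L \<rho> = - G"
      by (simp add: dagger_L_eq_flux[OF \<rho>(1,2)] G_def U_def)
    ultimately show "\<exists>G. riemannian_gradient (inv_densities \<A>)
        (\<lambda>\<rho> X Y. Re (trace (mat 1 :: complex^'n^'n)) * metric_L \<A> J V \<omega> \<rho> X Y)
        (\<lambda>\<rho>. rel_entropy \<rho> \<sigma>) \<rho> G \<and> dagger \<A> L \<rho> = - G"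
      by blast
  qed
qed

end
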